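(* For every $\varepsilon>0$ there exist constants $c_1(\varepsilon),c_2(\varepsilon)>0$, depending only on $\varepsilon$, such that the following holds. Let $u$ be a linear operator on $\ell_2^N$ such that $\|ue_j\|=1$ for all $j=1,\dots,N$. Then there exists a subset $\sigma$ of $\{1,\dots,N\}$ of cardinality $|\sigma|>(1-\varepsilon)\frac{N}{\|u\|^2}$ such that $$c_1(\varepsilon)\|x\|\le\|ux\|\le c_2(\varepsilon)\|x\|\qquad\text{for all }x\in\mathbb{R}^\sigma.$$
   Context: $\ell_2^N$ is the $N$-dimensional Euclidean space with canonical basis $e_1,\dots,e_N$. For $\sigma\subset\{1,\dots,N\}$, $\mathbb{R}^\sigma$ is the coordinate subspace spanned by $\{e_j:j\in\sigma\}$. $\|\cdot\|$ denotes the Euclidean norm of vectors and the operator norm of operators. *)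

theory Defs
  imports Complex_Main "Jordan_Normal_Form.VS_Connect"
begin

text \<open>
  The constants in the theorem must not depend on the dimension, so the dimension has to be
  quantified inside the formula and cannot be a type. Hence \<open>\<ell>\<^sub>2\<^sup>N\<close> is modelled on
  \<^term>\<open>carrier_vec N :: real vec set\<close>. Coordinates are indexed by \<open>0, \<dots>, N - 1\<close>
  instead of \<open>1, \<dots>, N\<close>.
\<close>

abbreviation ell2 :: "nat \<Rightarrow> (real, real vec) module" where
  "ell2 N \<equiv> module_vec TYPE(real) N"

text \<open>Nothing is required of \<open>u\<close> outside \<^term>\<open>carrier_vec N\<close>.\<close>

abbreviation linear_operator :: "nat \<Rightarrow> (real vec \<Rightarrow> real vec) \<Rightarrow> bool" where
  "linear_operator N u \<equiv> linear_map class_ring (ell2 N) (ell2 N) u"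

definition vnorm :: "real vec \<Rightarrow> real" where
  "vnorm x = sqrt (x \<bullet> x)"

text \<open>The set below is nonempty, and it is bounded above whenever \<open>u\<close> is a linear operator.\<close>

definition op_norm :: "nat \<Rightarrow> (real vec \<Rightarrow> real vec) \<Rightarrow> real" where
  "op_norm N u = Sup {vnorm (u x) | x. x \<in> carrier_vec N \<and> vnorm x \<le> 1}"

definition coord_subspace :: "nat \<Rightarrow> nat set \<Rightarrow> real vec set" where
  "coord_subspace N \<sigma> = LinearCombinations.module.span class_ring (ell2 N) (unit_vec N ` \<sigma>)"

end

theory Submission
  imports Defs "HOL-Analysis.Convex" "HOL-Library.Poly_Mapping"
begin

text \<open>
  Write \<open>w\<^sub>i = u e\<^sub>i\<close> for the unit vectors in question, \<open>M = \<parallel>u\<parallel>\<^sup>2\<close>, and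
  \<open>A\<^sub>S = \<Sum>\<^sub>i\<^sub>\<in>\<^sub>S w\<^sub>i w\<^sub>i\<^sup>T\<close>. Adjoining the vectors to \<open>S\<close> one at a time, the proof controls
  two barriers at once, in the manner of Batson, Spielman and Srivastava: an upper barrier \<open>t\<close> with
  \<open>A\<^sub>S < t\<close>, and a lower barrier \<open>b\<close> that stays below the spectrum of the Gram matrix of
  \<open>(w\<^sub>i)\<^sub>i\<^sub>\<in>\<^sub>S\<close>. Both are measured by the potential \<open>\<Psi>(c) = \<Sum>\<^sub>i w\<^sub>i\<^sup>T (c - A\<^sub>S)\<^sup>-\<^sup>1 w\<^sub>i\<close>, summed over
  the whole family. At \<open>c = t\<close> it has to stay small; at \<open>c = b\<close> it has to stay large, since a
  vector \<open>w\<close> may be adjoined above \<open>b\<close> exactly when \<open>w\<^sup>T (b - A\<^sub>S)\<^sup>-\<^sup>1 w > 1\<close>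
  (\<open>gram_above_insert_iff\<close>).

  Adjoining \<open>w\<close> spoils both potentials, by amounts given by the Sherman--Morrison formula. The loss is
  paid for by first moving the barriers, down for \<open>b\<close> and up for \<open>t\<close>, by a fixed multiple of \<open>M/N\<close>.
  Since \<open>\<Sum>\<^sub>i w\<^sub>i w\<^sub>i\<^sup>T \<le> M\<close>, the average loss over all \<open>i\<close> is governed by \<open>M/N \<Sum>\<^sub>i |(c - A\<^sub>S)\<^sup>-\<^sup>1 w\<^sub>i|\<^sup>2\<close>,
  which the gain from moving the barrier dominates (\<open>lower_shift\<close>, \<open>upper_shift\<close>). The lower estimate
  has room left for about \<open>N/M\<close> steps: the part of the family orthogonal to the \<open>k\<close> chosen
  vectors has mass at least \<open>N - kM\<close>, and this is what remains to be used. A good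
  index for the lower barrier exists on average, with a contribution that is bounded because \<open>b\<close> stays
  above a constant; placing the upper barrier high enough makes the indices that are bad for it so
  rare that some index is good for both (\<open>choose_vector\<close>).

  It suffices to treat \<open>\<epsilon> \<le> 1/2\<close>. The barriers move \<open>\<lfloor>(1 - \<epsilon>) N/M\<rfloor>\<close> times, by a total of \<open>O(1)\<close>, and
  one further vector is adjoined without moving the lower barrier, which makes the cardinality strictly larger than
  \<open>(1 - \<epsilon>) N/M\<close>. Bounds for the final positions of \<open>b\<close> and \<open>t\<close> are the squares of the two
  constants.

  This part of the argument takes place in an arbitrary real inner product space. Inverses of
  \<open>c - A\<^sub>S\<close> are built up by the Sherman--Morrison formula, so no finite-dimensionality enters. Since
  the dimension \<open>N\<close> varies inside the statement, all spaces \<open>\<ell>\<^sub>2\<^sup>N\<close> are then embedded into the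
  one space of finitely supported real sequences.
\<close>

(* Both scalar products are written with the same symbol; it is kept for the class operation. *)
no_notation scalar_prod (infix "\<bullet>" 70)

section \<open>Frame operators and their resolvents\<close>

definition frame_op :: "('i \<Rightarrow> 'a::real_inner) \<Rightarrow> 'i set \<Rightarrow> 'a \<Rightarrow> 'a" where
  "frame_op w S x = (\<Sum>j\<in>S. (w j \<bullet> x) *\<^sub>R w j)"

lemma linear_frame_op: "linear (frame_op w S)"
  by (rule linearI)
    (simp_all add: frame_op_def inner_right_distrib scaleR_add_left sum.distrib scaleR_sum_right)

lemma frame_op_insert:
  assumes "finite S" "i \<notin> S"
  shows "frame_op w (insert i S) x = frame_op w S x + (w i \<bullet> x) *\<^sub>R w i"
  using assms by (simp add: frame_op_def add.commute)

lemma frame_op_inner: "frame_op w S x \<bullet> y = (\<Sum>j\<in>S. (w j \<bullet> x) * (w j \<bullet> y))"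
  by (simp add: frame_op_def inner_sum_left)

lemma frame_op_symmetric: "frame_op w S x \<bullet> y = x \<bullet> frame_op w S y"
  by (simp add: frame_op_inner inner_commute[of x "frame_op w S y"] mult.commute)

lemma frame_op_in_span: "frame_op w S x \<in> span (w ` S)"
  unfolding frame_op_def by (intro span_sum span_scale span_base) auto

lemma synthesis_inner: "(\<Sum>j\<in>S. y j *\<^sub>R w j) \<bullet> x = (\<Sum>j\<in>S. y j * (w j \<bullet> x))"
  by (simp add: inner_sum_left)

text \<open>The inverse of \<open>b - A\<^sub>S\<close> is a two-sided inverse given as a relation: for the lower barrier the
  operator is indefinite, and the inverse exists only under the conditions established below.\<close>

definition resolvent :: "('i \<Rightarrow> 'a::real_inner) \<Rightarrow> 'i set \<Rightarrow> real \<Rightarrow> ('a \<Rightarrow> 'a) \<Rightarrow> bool" where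
  "resolvent w S b R \<longleftrightarrow> linear R \<and>
     (\<forall>x. R (b *\<^sub>R x - frame_op w S x) = x) \<and> (\<forall>x. b *\<^sub>R R x - frame_op w S (R x) = x)"

lemma resolvent_linear: "resolvent w S b R \<Longrightarrow> linear R"
  and resolvent_left: "resolvent w S b R \<Longrightarrow> R (b *\<^sub>R x - frame_op w S x) = x"
  and resolvent_right: "resolvent w S b R \<Longrightarrow> b *\<^sub>R R x - frame_op w S (R x) = x"
  by (auto simp: resolvent_def)

lemma resolvent_symmetric:
  assumes "resolvent w S b R"
  shows "R x \<bullet> y = x \<bullet> R y"
proof -
  have "R x \<bullet> y = R x \<bullet> (b *\<^sub>R R y - frame_op w S (R y))"
    by (simp add: resolvent_right[OF assms])
  also have "\<dots> = (b *\<^sub>R R x - frame_op w S (R x)) \<bullet> R y"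
    by (simp add: inner_diff_left inner_diff_right frame_op_symmetric)
  finally show ?thesis by (simp add: resolvent_right[OF assms])
qed

lemma resolvent_empty:
  assumes "b \<noteq> 0"
  shows "resolvent w {} b (\<lambda>x. x /\<^sub>R b)"
  using assms by (auto simp: resolvent_def frame_op_def linear_iff scaleR_add_right)

text \<open>The Sherman--Morrison formula for the rank-one update \<open>A\<^sub>S + w\<^sub>i w\<^sub>i\<^sup>T\<close>.\<close>

lemma resolvent_insert:
  fixes w :: "'i \<Rightarrow> 'a::real_inner"
  assumes R: "resolvent w S b R" and S: "finite S" "i \<notin> S" and s: "w i \<bullet> R (w i) \<noteq> 1"
  shows "resolvent w (insert i S) b
           (\<lambda>x. R x + ((w i \<bullet> R x) / (1 - w i \<bullet> R (w i))) *\<^sub>R R (w i))"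
    (is "resolvent _ _ _ ?R")
  unfolding resolvent_def
proof (intro conjI allI)
  define s where "s = w i \<bullet> R (w i)"
  have s1: "1 - s \<noteq> 0" using s by (simp add: s_def)
  note lin = resolvent_linear[OF R] and linA = linear_frame_op[of w S]
  show "linear ?R"
    by (rule linearI)
      (simp_all add: linear_add[OF lin] linear_scale[OF lin] inner_right_distrib add_divide_distrib
        scaleR_add_left scaleR_add_right)
  fix x
  have "R (b *\<^sub>R x - frame_op w (insert i S) x) = x - (w i \<bullet> x) *\<^sub>R R (w i)"
    using resolvent_left[OF R, of x]
    by (simp add: frame_op_insert[OF S] linear_diff[OF lin] linear_add[OF lin] linear_scale[OF lin]
        algebra_simps)
  moreover have "w i \<bullet> (x - (w i \<bullet> x) *\<^sub>R R (w i)) = (w i \<bullet> x) * (1 - s)"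
    by (simp add: inner_diff_right s_def algebra_simps)
  ultimately show "?R (b *\<^sub>R x - frame_op w (insert i S) x) = x"
    using s1 by (simp flip: s_def)
  define c where "c = (w i \<bullet> R x) / (1 - s)"
  have c: "c * (1 - s) = w i \<bullet> R x" using s1 by (simp add: c_def)
  have "b *\<^sub>R (R x + c *\<^sub>R R (w i)) - frame_op w (insert i S) (R x + c *\<^sub>R R (w i))
      = (b *\<^sub>R R x - frame_op w S (R x)) + c *\<^sub>R (b *\<^sub>R R (w i) - frame_op w S (R (w i)))
        - (w i \<bullet> R x + c * s) *\<^sub>R w i"
    by (simp add: frame_op_insert[OF S] linear_add[OF linA] linear_scale[OF linA]
        inner_right_distrib s_def algebra_simps)
  also have "\<dots> = x + (c - (w i \<bullet> R x + c * s)) *\<^sub>R w i"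
    by (simp add: resolvent_right[OF R] scaleR_diff_left)
  also have "c - (w i \<bullet> R x + c * s) = 0" using c by (simp add: algebra_simps)
  finally show "b *\<^sub>R ?R x - frame_op w (insert i S) (?R x) = x"
    by (simp add: c_def s_def)
qed

text \<open>The correction term has the sign of \<open>1 - w\<^sub>i\<^sup>T R w\<^sub>i\<close>: above the spectrum the potential grows,
  and at the lower barrier, where only vectors making it negative are adjoined, it decreases.\<close>

lemma potential_insert:
  fixes w :: "'i \<Rightarrow> 'a::real_inner"
  assumes R: "resolvent w S b R" and S: "finite S" "i \<notin> S" and s: "w i \<bullet> R (w i) \<noteq> 1"
  shows "\<exists>R'. resolvent w (insert i S) b R' \<and>
    (\<Sum>j\<in>I. w j \<bullet> R' (w j)) = (\<Sum>j\<in>I. w j \<bullet> R (w j))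
        + (\<Sum>j\<in>I. (w j \<bullet> R (w i))\<^sup>2) / (1 - w i \<bullet> R (w i))"
proof (intro exI conjI)
  show "resolvent w (insert i S) b
           (\<lambda>x. R x + ((w i \<bullet> R x) / (1 - w i \<bullet> R (w i))) *\<^sub>R R (w i))"
    using resolvent_insert[OF assms] .
  have sym: "(w i \<bullet> R (w j)) / r * (w j \<bullet> R (w i)) = (w j \<bullet> R (w i))\<^sup>2 / r" for j r
  proof -
    have "w i \<bullet> R (w j) = w j \<bullet> R (w i)" by (metis resolvent_symmetric[OF R] inner_commute)
    then show ?thesis by (simp only: power2_eq_square times_divide_eq_left)
  qed
  show "(\<Sum>j\<in>I. w j \<bullet> (R (w j) + ((w i \<bullet> R (w j)) / (1 - w i \<bullet> R (w i))) *\<^sub>R R (w i)))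
      = (\<Sum>j\<in>I. w j \<bullet> R (w j)) + (\<Sum>j\<in>I. (w j \<bullet> R (w i))\<^sup>2) / (1 - w i \<bullet> R (w i))"
    by (simp add: inner_right_distrib sum.distrib sum_divide_distrib flip: sym)
qed

lemma resolvent_difference:
  assumes R: "resolvent w S b R" and R': "resolvent w S b' R'"
  shows "R' x - R x = (b - b') *\<^sub>R R' (R x)"
proof -
  have "x = (b' *\<^sub>R R x - frame_op w S (R x)) + (b - b') *\<^sub>R R x"
    using resolvent_right[OF R, of x] by (simp add: algebra_simps)
  then have "R' x = R' (b' *\<^sub>R R x - frame_op w S (R x)) + (b - b') *\<^sub>R R' (R x)"
    by (metis linear_add[OF resolvent_linear[OF R']] linear_scale[OF resolvent_linear[OF R']])
  then show ?thesis by (simp add: resolvent_left[OF R'])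
qed

section \<open>Adding a vector at the lower and at the upper barrier\<close>

text \<open>The Gram matrix of \<open>(w\<^sub>j)\<^sub>j\<^sub>\<in>\<^sub>S\<close> is strictly above \<open>b\<close>. In particular the vectors are linearly
  independent when \<open>b > 0\<close>, which a condition on the nonzero spectrum of \<open>A\<^sub>S\<close> would not give.\<close>

definition gram_above :: "('i \<Rightarrow> 'a::real_inner) \<Rightarrow> 'i set \<Rightarrow> real \<Rightarrow> bool" where
  "gram_above w S b \<longleftrightarrow> (\<forall>y. (\<exists>j\<in>S. y j \<noteq> 0) \<longrightarrow>
      b * (\<Sum>j\<in>S. (y j)\<^sup>2) < (\<Sum>j\<in>S. y j *\<^sub>R w j) \<bullet> (\<Sum>j\<in>S. y j *\<^sub>R w j))"

lemma gram_aboveD: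
  assumes "gram_above w S b"
  shows "b * (\<Sum>j\<in>S. (y j)\<^sup>2) \<le> (\<Sum>j\<in>S. y j *\<^sub>R w j) \<bullet> (\<Sum>j\<in>S. y j *\<^sub>R w j)"
proof (cases "\<exists>j\<in>S. y j \<noteq> 0")
  case True
  then show ?thesis using assms unfolding gram_above_def by (meson less_imp_le)
qed simp

lemma gram_above_mono:
  assumes "gram_above w S b" "b' \<le> b"
  shows "gram_above w S b'"
  unfolding gram_above_def
proof (intro allI impI)
  fix y :: "'a \<Rightarrow> real" assume "\<exists>j\<in>S. y j \<noteq> 0"
  then have "b * (\<Sum>j\<in>S. (y j)\<^sup>2) < (\<Sum>j\<in>S. y j *\<^sub>R w j) \<bullet> (\<Sum>j\<in>S. y j *\<^sub>R w j)"
    using assms(1) by (simp add: gram_above_def)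
  moreover have "b' * (\<Sum>j\<in>S. (y j)\<^sup>2) \<le> b * (\<Sum>j\<in>S. (y j)\<^sup>2)"
    using assms(2) by (intro mult_right_mono sum_nonneg) auto
  ultimately show "b' * (\<Sum>j\<in>S. (y j)\<^sup>2) < (\<Sum>j\<in>S. y j *\<^sub>R w j) \<bullet> (\<Sum>j\<in>S. y j *\<^sub>R w j)"
    by linarith
qed

text \<open>The Schur complement of the enlarged Gram matrix minus \<open>b\<close>, read off by completing the
  square: for fixed coefficient \<open>a\<close> of \<open>w\<^sub>i\<close> the critical point is \<open>y\<^sub>j = a (w\<^sub>j \<bullet> z)\<close>, and the
  identity \<open>w\<^sub>i + A\<^sub>S z = b z\<close> makes the remainder \<open>b a\<^sup>2 (w\<^sub>i \<bullet> z - 1)\<close>.\<close>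

lemma gram_complete_square:
  fixes w :: "'i \<Rightarrow> 'a::real_inner" and y :: "'i \<Rightarrow> real" and a b :: real and i :: 'i
  assumes R: "resolvent w S b R"
  defines "z \<equiv> R (w i)"
  defines "p \<equiv> (\<Sum>j\<in>S. y j *\<^sub>R w j)"
  defines "p' \<equiv> (\<Sum>j\<in>S. (y j - a * (w j \<bullet> z)) *\<^sub>R w j)"
  shows "(p + a *\<^sub>R w i) \<bullet> (p + a *\<^sub>R w i) - b * ((\<Sum>j\<in>S. (y j)\<^sup>2) + a\<^sup>2)
    = p' \<bullet> p' - b * (\<Sum>j\<in>S. (y j - a * (w j \<bullet> z))\<^sup>2) + b * a\<^sup>2 * (w i \<bullet> z - 1)"
proof -
  define A where "A = frame_op w S z"
  have wi: "w i = b *\<^sub>R z - A" using resolvent_right[OF R, of "w i"] by (simp add: z_def A_def)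
  have "p' + a *\<^sub>R A = (\<Sum>j\<in>S. (y j - a * (w j \<bullet> z)) *\<^sub>R w j + (a * (w j \<bullet> z)) *\<^sub>R w j)"
    by (simp add: p'_def A_def frame_op_def scaleR_sum_right sum.distrib)
  then have p: "p = p' + a *\<^sub>R A"
    by (simp add: p_def flip: scaleR_add_left)
  have pz: "p' \<bullet> z = (\<Sum>j\<in>S. (y j - a * (w j \<bullet> z)) * (w j \<bullet> z))"
    by (simp add: p'_def synthesis_inner)
  have Az: "A \<bullet> z = (\<Sum>j\<in>S. (w j \<bullet> z) * (w j \<bullet> z))" by (simp add: A_def frame_op_inner)
  have sq: "(y j)\<^sup>2 = (y j - a * (w j \<bullet> z))\<^sup>2 + 2 * a * ((y j - a * (w j \<bullet> z)) * (w j \<bullet> z))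
      + a\<^sup>2 * ((w j \<bullet> z) * (w j \<bullet> z))" for j
    by (simp add: power2_eq_square algebra_simps)
  have "(\<Sum>j\<in>S. (y j)\<^sup>2) = (\<Sum>j\<in>S. (y j - a * (w j \<bullet> z))\<^sup>2
      + 2 * a * ((y j - a * (w j \<bullet> z)) * (w j \<bullet> z)) + a\<^sup>2 * ((w j \<bullet> z) * (w j \<bullet> z)))"
    by (intro sum.cong refl sq)
  then have Y: "(\<Sum>j\<in>S. (y j)\<^sup>2)
      = (\<Sum>j\<in>S. (y j - a * (w j \<bullet> z))\<^sup>2) + 2 * a * (p' \<bullet> z) + a\<^sup>2 * (A \<bullet> z)"
    unfolding pz Az sum.distrib sum_distrib_left .
  have "p + a *\<^sub>R w i = p' + (a * b) *\<^sub>R z"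
    by (simp add: p wi algebra_simps)
  then have X: "(p + a *\<^sub>R w i) \<bullet> (p + a *\<^sub>R w i) = p' \<bullet> p' + 2 * a * b * (p' \<bullet> z) + a\<^sup>2 * b\<^sup>2 * (z \<bullet> z)"
    by (simp add: inner_left_distrib inner_right_distrib inner_commute power2_eq_square)
  have W: "w i \<bullet> z = b * (z \<bullet> z) - A \<bullet> z" by (simp add: wi inner_diff_left)
  have "P + 2 * a * b * c + a\<^sup>2 * b\<^sup>2 * d - b * ((Q + 2 * a * c + a\<^sup>2 * e) + a\<^sup>2)
      = P - b * Q + b * a\<^sup>2 * (b * d - e - 1)" for P Q c d e :: real
    by (simp add: power2_eq_square algebra_simps)
  then show ?thesis unfolding X Y W .
qed

lemma gram_above_insert_iff:
  fixes w :: "'i \<Rightarrow> 'a::real_inner"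
  assumes R: "resolvent w S b R" and S: "finite S" "i \<notin> S" and b: "b > 0" and lb: "gram_above w S b"
  shows "gram_above w (insert i S) b \<longleftrightarrow> w i \<bullet> R (w i) > 1"
proof
  define z where "z = R (w i)"
  note sq = gram_complete_square[OF R, of _ _ i, folded z_def]
  {
    assume above: "gram_above w (insert i S) b"
    define y where "y = (\<lambda>j. if j = i then 1 else w j \<bullet> z)"
    have yS: "y j = w j \<bullet> z" if "j \<in> S" for j using that S by (auto simp: y_def)
    have "b * (\<Sum>j\<in>insert i S. (y j)\<^sup>2)
        < (\<Sum>j\<in>insert i S. y j *\<^sub>R w j) \<bullet> (\<Sum>j\<in>insert i S. y j *\<^sub>R w j)"
      using above unfolding gram_above_def by (auto simp: y_def)
    then have "0 < ((\<Sum>j\<in>S. (w j \<bullet> z) *\<^sub>R w j) + 1 *\<^sub>R w i) \<bullet> ((\<Sum>j\<in>S. (w j \<bullet> z) *\<^sub>R w j) + 1 *\<^sub>R w i)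
        - b * ((\<Sum>j\<in>S. (w j \<bullet> z)\<^sup>2) + 1\<^sup>2)"
      using S yS by (simp add: y_def add.commute cong: sum.cong_simp)
    also have "\<dots> = b * (w i \<bullet> z - 1)"
      by (subst sq) simp
    finally show "w i \<bullet> R (w i) > 1" using b by (simp add: zero_less_mult_iff z_def)
  }
  assume s: "w i \<bullet> R (w i) > 1"
  show "gram_above w (insert i S) b"
    unfolding gram_above_def
  proof (intro allI impI)
    fix y :: "'i \<Rightarrow> real" assume y: "\<exists>j\<in>insert i S. y j \<noteq> 0"
    let ?y = "\<lambda>j. y j - y i * (w j \<bullet> z)"
    let ?p = "\<Sum>j\<in>S. y j *\<^sub>R w j" and ?p' = "\<Sum>j\<in>S. ?y j *\<^sub>R w j"
    have "0 < ?p' \<bullet> ?p' - b * (\<Sum>j\<in>S. (?y j)\<^sup>2) + b * (y i)\<^sup>2 * (w i \<bullet> z - 1)"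
    proof (cases "y i = 0")
      case True
      then have "\<exists>j\<in>S. ?y j \<noteq> 0" using y by auto
      then show ?thesis using lb True by (auto simp: gram_above_def)
    next
      case False
      then have "b * (y i)\<^sup>2 * (w i \<bullet> z - 1) > 0" using b s by (simp add: z_def)
      then show ?thesis using gram_aboveD[OF lb, of ?y] by linarith
    qed
    then have "0 < (?p + y i *\<^sub>R w i) \<bullet> (?p + y i *\<^sub>R w i) - b * ((\<Sum>j\<in>S. (y j)\<^sup>2) + (y i)\<^sup>2)"
      by (subst sq)
    then show "b * (\<Sum>j\<in>insert i S. (y j)\<^sup>2)
        < (\<Sum>j\<in>insert i S. y j *\<^sub>R w j) \<bullet> (\<Sum>j\<in>insert i S. y j *\<^sub>R w j)"
      using S by (simp add: add.commute)
  qed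
qed

lemma gram_above_subset:
  assumes "gram_above w T b" "S \<subseteq> T" "finite T"
  shows "gram_above w S b"
  unfolding gram_above_def
proof (intro allI impI)
  fix y :: "'a \<Rightarrow> real" assume y: "\<exists>j\<in>S. y j \<noteq> 0"
  let ?y = "\<lambda>j. if j \<in> S then y j else 0"
  obtain j where "j \<in> S" "y j \<noteq> 0" using y by blast
  then have "\<exists>j\<in>T. ?y j \<noteq> 0" using assms(2) by (intro bexI[of _ j]) auto
  then have "b * (\<Sum>j\<in>T. (?y j)\<^sup>2) < (\<Sum>j\<in>T. ?y j *\<^sub>R w j) \<bullet> (\<Sum>j\<in>T. ?y j *\<^sub>R w j)"
    using assms(1)[unfolded gram_above_def, rule_format, of ?y] by simp
  moreover have "(\<Sum>j\<in>T. (?y j)\<^sup>2) = (\<Sum>j\<in>S. (y j)\<^sup>2)"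
    using assms(2,3) by (intro sum.mono_neutral_cong_right) auto
  moreover have "(\<Sum>j\<in>T. ?y j *\<^sub>R w j) = (\<Sum>j\<in>S. y j *\<^sub>R w j)"
    using assms(2,3) by (intro sum.mono_neutral_cong_right) auto
  ultimately show "b * (\<Sum>j\<in>S. (y j)\<^sup>2) < (\<Sum>j\<in>S. y j *\<^sub>R w j) \<bullet> (\<Sum>j\<in>S. y j *\<^sub>R w j)"
    by simp
qed

text \<open>Each subset of \<open>S\<close> satisfies the same lower bound, so by \<open>gram_above_insert_iff\<close> the
  Sherman--Morrison denominators never vanish while \<open>S\<close> is built up from the empty set.\<close>

lemma resolvent_exists_of_gram_above:
  assumes "finite S" "b > 0" "gram_above w S b"
  shows "\<exists>R. resolvent w S b R"
  using assms(1,3)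
proof (induction S)
  case empty
  then show ?case using resolvent_empty[of b w] assms(2) by auto
next
  case (insert i S)
  have lb: "gram_above w S b"
    using gram_above_subset[OF insert.prems] insert.hyps by blast
  obtain R where R: "resolvent w S b R" using insert.IH lb by blast
  have "w i \<bullet> R (w i) > 1"
    using gram_above_insert_iff[OF R insert.hyps assms(2) lb] insert.prems by simp
  then show ?case using resolvent_insert[OF R insert.hyps] by auto
qed

definition frame_below :: "('i \<Rightarrow> 'a::real_inner) \<Rightarrow> 'i set \<Rightarrow> real \<Rightarrow> bool" where
  "frame_below w S t \<longleftrightarrow> (\<forall>x. x \<noteq> 0 \<longrightarrow> frame_op w S x \<bullet> x < t * (x \<bullet> x))"

lemma frame_belowD: "frame_below w S t \<Longrightarrow> frame_op w S x \<bullet> x \<le> t * (x \<bullet> x)"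
  by (cases "x = 0") (auto simp: frame_below_def less_imp_le)

lemma frame_below_mono:
  assumes "frame_below w S t" "t \<le> t'"
  shows "frame_below w S t'"
  unfolding frame_below_def
proof (intro allI impI)
  fix x :: 'b assume "x \<noteq> 0"
  then have "frame_op w S x \<bullet> x < t * (x \<bullet> x)" using assms(1) by (simp add: frame_below_def)
  also have "\<dots> \<le> t' * (x \<bullet> x)" using assms(2) by (intro mult_right_mono) auto
  finally show "frame_op w S x \<bullet> x < t' * (x \<bullet> x)" .
qed

text \<open>For \<open>z = R w\<^sub>i\<close> the number \<open>w\<^sub>i \<bullet> z\<close> is both the value of the form \<open>t - A\<^sub>S\<close> at \<open>z\<close> and its
  pairing with \<open>w\<^sub>i\<close>. Hence testing the enlarged form at \<open>z\<close> gives one direction, and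
  the other is the Cauchy--Schwarz inequality for the positive form \<open>t - A\<^sub>S\<close>.\<close>

lemma frame_below_insert_iff:
  fixes w :: "'i \<Rightarrow> 'a::real_inner"
  assumes R: "resolvent w S t R" and S: "finite S" "i \<notin> S" and ub: "frame_below w S t"
  shows "frame_below w (insert i S) t \<longleftrightarrow> w i \<bullet> R (w i) < 1"
proof
  define z where "z = R (w i)"
  have wi: "w i = t *\<^sub>R z - frame_op w S z" using resolvent_right[OF R, of "w i"] by (simp add: z_def)
  have s': "w i \<bullet> z = t * (z \<bullet> z) - frame_op w S z \<bullet> z"
    by (subst wi) (simp add: inner_diff_left)
  {
    assume below: "frame_below w (insert i S) t"
    show "w i \<bullet> R (w i) < 1"
    proof (cases "z = 0")
      case True
      then show ?thesis by (simp add: z_def)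
    next
      case False
      then have "frame_op w (insert i S) z \<bullet> z < t * (z \<bullet> z)"
        using below by (simp add: frame_below_def)
      then have "(w i \<bullet> z) * (w i \<bullet> z) < t * (z \<bullet> z) - frame_op w S z \<bullet> z"
        by (simp add: frame_op_insert[OF S] inner_left_distrib)
      also have "\<dots> = w i \<bullet> z" by (simp add: s')
      finally have "(w i \<bullet> z) * (w i \<bullet> z) < w i \<bullet> z" .
      then show ?thesis
        unfolding z_def[symmetric] by (smt (verit) mult_le_cancel_left1 zero_le_square)
    qed
  }
  assume s: "w i \<bullet> R (w i) < 1"
  show "frame_below w (insert i S) t"
    unfolding frame_below_def
  proof (intro allI impI)
    fix x :: 'a assume x: "x \<noteq> 0"
    \<comment> \<open>Evaluating the old form at \<open>x - c z\<close>.\<close>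
    define c where "c = w i \<bullet> x"
    let ?v = "x - c *\<^sub>R z"
    have c': "c = t * (z \<bullet> x) - frame_op w S z \<bullet> x"
      unfolding c_def by (subst wi) (simp add: inner_diff_left)
    have sym: "frame_op w S x \<bullet> z = frame_op w S z \<bullet> x"
      by (metis frame_op_symmetric inner_commute)
    have "0 \<le> t * (?v \<bullet> ?v) - frame_op w S ?v \<bullet> ?v" using frame_belowD[OF ub, of ?v] by simp
    also have "\<dots> = (t * (x \<bullet> x) - frame_op w S x \<bullet> x)
        - 2 * c * (t * (z \<bullet> x) - frame_op w S z \<bullet> x) + c\<^sup>2 * (t * (z \<bullet> z) - frame_op w S z \<bullet> z)"
      by (simp add: linear_diff[OF linear_frame_op] linear_scale[OF linear_frame_op] sym
          inner_commute[of x z] inner_diff_left inner_diff_right power2_eq_square algebra_simps)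
    also have "\<dots> = (t * (x \<bullet> x) - frame_op w S x \<bullet> x) - c\<^sup>2 - c\<^sup>2 * (1 - w i \<bullet> z)"
      by (simp only: c'[symmetric] s'[symmetric]) (simp add: power2_eq_square algebra_simps)
    finally have *: "c\<^sup>2 * (1 - w i \<bullet> z) \<le> t * (x \<bullet> x) - frame_op w S x \<bullet> x - c\<^sup>2" by simp
    have "0 < t * (x \<bullet> x) - frame_op w S x \<bullet> x - c\<^sup>2"
    proof (cases "c = 0")
      case True
      then show ?thesis using ub x by (simp add: frame_below_def)
    next
      case False
      then have "c\<^sup>2 * (1 - w i \<bullet> z) > 0" using s by (simp add: z_def)
      then show ?thesis using * by linarith
    qed
    then show "frame_op w (insert i S) x \<bullet> x < t * (x \<bullet> x)"
      by (simp add: frame_op_insert[OF S] inner_left_distrib c_def power2_eq_square)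
  qed
qed

lemma frame_below_remove:
  assumes "frame_below w (insert i S) t" "finite S" "i \<notin> S"
  shows "frame_below w S t"
  unfolding frame_below_def
proof (intro allI impI)
  fix x :: 'b assume "x \<noteq> 0"
  then have "frame_op w S x \<bullet> x + (w i \<bullet> x) * (w i \<bullet> x) < t * (x \<bullet> x)"
    using assms(1) by (simp add: frame_below_def frame_op_insert[OF assms(2,3)] inner_left_distrib)
  then show "frame_op w S x \<bullet> x < t * (x \<bullet> x)"
    using zero_le_square[of "w i \<bullet> x"] by linarith
qed

lemma resolvent_exists_of_frame_below:
  assumes "finite S" "t > 0" "frame_below w S t"
  shows "\<exists>R. resolvent w S t R"
  using assms(1,3)
proof (induction S)
  case empty
  then show ?case using resolvent_empty[of t w] assms(2) by auto
next
  case (insert i S)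
  have ub: "frame_below w S t"
    using frame_below_remove[OF insert.prems] insert.hyps by blast
  obtain R where R: "resolvent w S t R" using insert.IH ub by blast
  have "w i \<bullet> R (w i) < 1"
    using frame_below_insert_iff[OF R insert.hyps ub] insert.prems by simp
  then show ?case using resolvent_insert[OF R insert.hyps] by auto
qed

section \<open>Moving the lower barrier\<close>

lemma span_image_synthesis:
  assumes "finite S" "x \<in> span (w ` S)"
  shows "\<exists>y. x = (\<Sum>j\<in>S. y j *\<^sub>R w j)"
  using assms(2)
proof (induction rule: span_induct_alt)
  case base
  show ?case by (rule exI[of _ "\<lambda>_. 0"]) simp
next
  case (step c v x)
  obtain y where y: "x = (\<Sum>j\<in>S. y j *\<^sub>R w j)" using step by blast
  obtain k where k: "k \<in> S" "v = w k" using step by blast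
  have "(\<Sum>j\<in>S. (y j + (if j = k then c else 0)) *\<^sub>R w j)
      = (\<Sum>j\<in>S. y j *\<^sub>R w j) + (\<Sum>j\<in>S. if j = k then c *\<^sub>R w j else 0)"
    by (simp add: scaleR_add_left sum.distrib if_distrib[of "\<lambda>c. c *\<^sub>R _"] cong: if_cong)
  also have "\<dots> = c *\<^sub>R v + x" using k y assms(1) by simp
  finally have "c *\<^sub>R v + x = (\<Sum>j\<in>S. (y j + (if j = k then c else 0)) *\<^sub>R w j)" by simp
  then show ?case by (intro exI[of _ "\<lambda>j. y j + (if j = k then c else 0)"])
qed

text \<open>The next two lemmas say that every spectral value of \<open>A\<^sub>S\<close> is zero or at least \<open>b\<close>, in the two
  forms that replace a diagonalisation of \<open>A\<^sub>S\<close>: \<open>A\<^sub>S\<^sup>2 \<ge> b A\<^sub>S\<close> on the whole space,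
  and \<open>A\<^sub>S \<ge> b\<close> on the span of the chosen vectors.\<close>

lemma gram_above_frame_op_square:
  assumes "gram_above w S b"
  shows "b * (frame_op w S x \<bullet> x) \<le> frame_op w S x \<bullet> frame_op w S x"
proof -
  have "(\<Sum>j\<in>S. (w j \<bullet> x)\<^sup>2) = frame_op w S x \<bullet> x"
    by (simp add: frame_op_inner power2_eq_square)
  then show ?thesis
    using gram_aboveD[OF assms, of "\<lambda>j. w j \<bullet> x"] by (simp flip: frame_op_def)
qed

lemma gram_above_frame_op_span:
  assumes "finite S" "b > 0" "gram_above w S b" "x \<in> span (w ` S)"
  shows "b * (x \<bullet> x) \<le> frame_op w S x \<bullet> x"
proof -
  obtain y where y: "x = (\<Sum>j\<in>S. y j *\<^sub>R w j)"
    using span_image_synthesis[OF assms(1,4)] by blast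
  have "x \<bullet> x = (\<Sum>j\<in>S. y j * (w j \<bullet> x))"
    by (subst y) (rule synthesis_inner)
  then have "(x \<bullet> x)\<^sup>2 \<le> (\<Sum>j\<in>S. (y j)\<^sup>2) * (\<Sum>j\<in>S. (w j \<bullet> x)\<^sup>2)"
    by (simp add: Cauchy_Schwarz_ineq_sum)
  then have "b * (x \<bullet> x)\<^sup>2 \<le> b * ((\<Sum>j\<in>S. (y j)\<^sup>2) * (\<Sum>j\<in>S. (w j \<bullet> x)\<^sup>2))"
    using assms(2) by simp
  also have "\<dots> = (b * (\<Sum>j\<in>S. (y j)\<^sup>2)) * (frame_op w S x \<bullet> x)"
    by (simp add: frame_op_inner power2_eq_square)
  also have "\<dots> \<le> (x \<bullet> x) * (frame_op w S x \<bullet> x)"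
    using gram_aboveD[OF assms(3), of y]
    by (intro mult_right_mono) (auto simp: y[symmetric] frame_op_inner intro!: sum_nonneg)
  finally have "(x \<bullet> x) * (b * (x \<bullet> x)) \<le> (x \<bullet> x) * (frame_op w S x \<bullet> x)"
    by (simp add: power2_eq_square algebra_simps)
  then show ?thesis
    by (cases "x = 0") auto
qed

lemma resolvent_le_of_gram_above:
  assumes "b > 0" "gram_above w S b" "resolvent w S b R"
  shows "x \<bullet> R x \<le> x \<bullet> x / b"
proof -
  let ?A = "frame_op w S (R x)"
  have x: "x = b *\<^sub>R R x - ?A" using resolvent_right[OF assms(3), of x] by simp
  have "x \<bullet> x - b * (x \<bullet> R x) = x \<bullet> (x - b *\<^sub>R R x)" by (simp add: inner_diff_right)
  also have "x - b *\<^sub>R R x = - ?A" using resolvent_right[OF assms(3), of x] by (simp add: algebra_simps)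
  also have "x \<bullet> - ?A = ?A \<bullet> ?A - b * (?A \<bullet> R x)"
    using arg_cong[OF x, of "\<lambda>y. ?A \<bullet> y"]
    by (simp add: inner_diff_right inner_commute[of x])
  also have "\<dots> \<ge> 0" using gram_above_frame_op_square[OF assms(2), of "R x"] by simp
  finally show ?thesis using assms(1) by (simp add: field_simps)
qed

text \<open>On the span \<open>b - A\<^sub>S\<close> is negative. Hence the criterion \<open>w \<bullet> R w > 1\<close> never selects a
  vector that has been chosen before.\<close>

lemma resolvent_nonpos_on_span:
  assumes "finite S" "b > 0" "gram_above w S b" "resolvent w S b R" "x \<in> span (w ` S)"
  shows "x \<bullet> R x \<le> 0"
proof -
  have "R x = (x + frame_op w S (R x)) /\<^sub>R b"
  proof -
    have "b *\<^sub>R R x = x + frame_op w S (R x)"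
      using resolvent_right[OF assms(4), of x] by (simp add: algebra_simps)
    moreover have "R x = (b *\<^sub>R R x) /\<^sub>R b" using assms(2) by simp
    ultimately show ?thesis by metis
  qed
  moreover have "(x + frame_op w S (R x)) /\<^sub>R b \<in> span (w ` S)"
    using assms(5) by (intro span_scale span_add frame_op_in_span)
  ultimately have "b * (R x \<bullet> R x) \<le> frame_op w S (R x) \<bullet> R x"
    using gram_above_frame_op_span[OF assms(1-3)] by metis
  moreover have "x \<bullet> R x = b * (R x \<bullet> R x) - frame_op w S (R x) \<bullet> R x"
    using resolvent_right[OF assms(4), of x] by (metis inner_diff_left inner_scaleR_left)
  ultimately show ?thesis by simp
qed

text \<open>The span has dimension at most \<open>card S\<close>, and each direction carries mass at most \<open>M\<close> of the
  family.\<close>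

lemma projection_onto_span:
  fixes w :: "'i \<Rightarrow> 'a::real_inner" and M :: real
  assumes S: "finite S" and I: "finite I"
    and frame: "\<And>x. (\<Sum>i\<in>I. (w i \<bullet> x)\<^sup>2) \<le> M * (x \<bullet> x)" and M: "M \<ge> 0"
  shows "\<exists>P. (\<forall>x. P x \<in> span (w ` S)) \<and> (\<forall>x. \<forall>j\<in>S. w j \<bullet> (x - P x) = 0)
    \<and> (\<Sum>i\<in>I. w i \<bullet> P (w i)) \<le> M * card S"
proof -
  obtain C where C: "finite C" "card C \<le> card (w ` S)" "span C = span (w ` S)" "pairwise orthogonal C"
    using basis_orthogonal[of "w ` S"] S by blast
  define P where "P x = (\<Sum>c\<in>C. (c \<bullet> x / (c \<bullet> c)) *\<^sub>R c)" for x
  have P_span: "P x \<in> span (w ` S)" for x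
    unfolding P_def C(3)[symmetric] by (intro span_sum span_scale span_base) auto
  have orthC: "c \<bullet> (x - P x) = 0" if c: "c \<in> C" for c x
  proof -
    have "c \<bullet> P x = (\<Sum>d\<in>C. (d \<bullet> x / (d \<bullet> d)) * (c \<bullet> d))"
      by (simp add: P_def inner_sum_right)
    also have "\<dots> = (\<Sum>d\<in>C. if d = c then c \<bullet> x else 0)"
      using C(4) c by (intro sum.cong) (auto simp: pairwise_def orthogonal_def)
    also have "\<dots> = c \<bullet> x" using c C(1) by simp
    finally show ?thesis by (simp add: inner_diff_right)
  qed
  have orth: "v \<bullet> (x - P x) = 0" if "v \<in> span (w ` S)" for v x
    using that unfolding C(3)[symmetric]
    by (induction rule: span_induct_alt) (auto simp: inner_left_distrib orthC)
  have "(\<Sum>i\<in>I. w i \<bullet> P (w i)) = (\<Sum>i\<in>I. \<Sum>c\<in>C. (w i \<bullet> c)\<^sup>2 / (c \<bullet> c))"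
    by (simp add: P_def inner_sum_right power2_eq_square inner_commute)
  also have "\<dots> = (\<Sum>c\<in>C. (\<Sum>i\<in>I. (w i \<bullet> c)\<^sup>2) / (c \<bullet> c))"
    by (subst sum.swap) (simp add: sum_divide_distrib)
  also have "\<dots> \<le> (\<Sum>c\<in>C. M)"
  proof (rule sum_mono)
    fix c
    show "(\<Sum>i\<in>I. (w i \<bullet> c)\<^sup>2) / (c \<bullet> c) \<le> M"
      using frame[of c] M by (cases "c = 0") (auto simp: divide_le_eq)
  qed
  also have "\<dots> = M * card C" by simp
  also have "\<dots> \<le> M * card S"
    using C(2) card_image_le[OF S, of w] M by (intro mult_left_mono) auto
  finally show ?thesis
    using P_span by (intro exI[of _ P] conjI allI ballI orth) (auto intro: span_base)
qed

text \<open>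
  Here \<open>R = (b - A\<^sub>S)\<^sup>-\<^sup>1\<close> and \<open>R' = (b' - A\<^sub>S)\<^sup>-\<^sup>1\<close> for \<open>b' < b\<close>. By the resolvent
  identity the potential gains \<open>(b - b') (R' x \<bullet> R x)\<close>, and this has to be compared with \<open>|R' x|\<^sup>2\<close>.
  On the span, where \<open>A\<^sub>S \<ge> b > b'\<close>, the comparison \<open>R'\<^sup>2 \<le> R' R\<close> goes the right way. On the
  orthogonal complement \<open>R' = 1/b'\<close> exceeds \<open>R = 1/b\<close>, so the complementary component
  \<open>z\<close> of \<open>x\<close> appears as an error in the second estimate, and as a source of gain in the first.\<close>

lemma lower_shift_pointwise:
  fixes w :: "'i \<Rightarrow> 'a::real_inner"
  assumes S: "finite S" and b: "0 < b'" "b' < b" and lb: "gram_above w S b"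
    and R: "resolvent w S b R" and R': "resolvent w S b' R'"
    and p: "p \<in> span (w ` S)" and z: "\<And>j. j \<in> S \<Longrightarrow> w j \<bullet> z = 0"
  defines "x \<equiv> p + z"
  shows "z \<bullet> z / (b * b') \<le> R' x \<bullet> R x"
    and "R' x \<bullet> R' x \<le> R' x \<bullet> R x + (b - b') * (z \<bullet> z / (b * b'\<^sup>2))"
    and "x \<bullet> R' x = x \<bullet> R x + (b - b') * (R' x \<bullet> R x)"
proof -
  let ?A = "frame_op w S"
  note linA = linear_frame_op[of w S]
  have b0: "b > 0" using b by simp
  define h where "h = R' (R x)"
  have h2: "h = R (R' x)"
  proof -
    have "(b - b') *\<^sub>R R' (R x) = (b - b') *\<^sub>R R (R' x)"
      using resolvent_difference[OF R R', of x] resolvent_difference[OF R' R, of x]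
      by (smt (verit) minus_diff_eq scaleR_minus_left)
    then show ?thesis using b by (simp add: h_def)
  qed
  have Rx: "R x = b' *\<^sub>R h - ?A h" and R'x: "R' x = b *\<^sub>R h - ?A h"
    using resolvent_right[OF R', of "R x"] resolvent_right[OF R, of "R' x"] h_def h2 by auto
  have diff: "R' x = R x + (b - b') *\<^sub>R h"
    using resolvent_difference[OF R R', of x] by (simp add: h_def algebra_simps)
  define g where "g = z /\<^sub>R (b * b')"
  \<comment> \<open>The splitting of \<open>h = R' R x\<close> into its parts in the span and orthogonal to it.\<close>
  define f where "f = h - g"
  have Ag: "?A g = 0" using z by (simp add: frame_op_def g_def)
  have g: "g \<bullet> w j = 0" if "j \<in> S" for j using z[OF that] by (simp add: g_def inner_commute)
  have g_span: "g \<bullet> v = 0" if "v \<in> span (w ` S)" for v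
    using that by (induction rule: span_induct_alt) (auto simp: inner_right_distrib g)
  define v where "v = (b + b') *\<^sub>R h - ?A h"
  have "x = b *\<^sub>R R x - ?A (R x)" using resolvent_right[OF R, of x] by simp
  also have "\<dots> = (b * b') *\<^sub>R h - ?A v"
    unfolding Rx v_def
    by (simp add: linear_diff[OF linA] linear_add[OF linA] linear_scale[OF linA]
        scaleR_add_left scaleR_diff_right)
  finally have bh: "(b * b') *\<^sub>R h = x + ?A v" by simp
  have bg: "(b * b') *\<^sub>R g = z" using b b0 by (simp add: g_def field_simps)
  have "(b * b') *\<^sub>R f = p + ?A v"
    unfolding f_def scaleR_diff_right bh bg by (simp add: x_def)
  moreover have "f = ((b * b') *\<^sub>R f) /\<^sub>R (b * b')" using b b0 by (simp add: field_simps)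
  ultimately have "f = (p + ?A v) /\<^sub>R (b * b')" by simp
  then have f: "f \<in> span (w ` S)"
    using p by (auto intro!: span_scale span_add frame_op_in_span)
  have h: "h = f + g" by (simp add: f_def)
  have gf: "g \<bullet> f = 0" "f \<bullet> g = 0" and gA: "g \<bullet> ?A f = 0" "?A f \<bullet> g = 0"
    using g_span f frame_op_in_span inner_commute by metis+
  have Ah: "?A h = ?A f" by (simp add: h linear_add[OF linA] Ag)
  have Rx': "R x = b' *\<^sub>R (f + g) - ?A f" and R'x': "R' x = b *\<^sub>R (f + g) - ?A f"
    using Rx R'x Ah h by metis+
  have pos: "b * (f \<bullet> f) \<le> ?A f \<bullet> f" by (rule gram_above_frame_op_span[OF S b0 lb f])
  have gg: "z \<bullet> z / (b * b') = b * b' * (g \<bullet> g)"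
    using b by (simp add: g_def field_simps)
  have "R' x \<bullet> R x = b * b' * (g \<bullet> g)
      + (b *\<^sub>R f - ?A f) \<bullet> (b *\<^sub>R f - ?A f) + (b - b') * (?A f \<bullet> f - b * (f \<bullet> f))"
    unfolding Rx' R'x' using gf gA
    by (simp add: inner_diff_left inner_diff_right inner_left_distrib inner_right_distrib
        inner_commute[of f "?A f"] algebra_simps)
  moreover have "(b *\<^sub>R f - ?A f) \<bullet> (b *\<^sub>R f - ?A f) \<ge> 0" by simp
  moreover have "(b - b') * (?A f \<bullet> f - b * (f \<bullet> f)) \<ge> 0" using pos b by simp
  ultimately show "z \<bullet> z / (b * b') \<le> R' x \<bullet> R x" unfolding gg by linarith
  have "R' x \<bullet> h = b * (g \<bullet> g) + (b * (f \<bullet> f) - ?A f \<bullet> f)"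
    unfolding R'x' h using gf gA
    by (simp add: inner_diff_left inner_left_distrib inner_right_distrib algebra_simps)
  then have "R' x \<bullet> h \<le> b * (g \<bullet> g)" using pos by simp
  also have "\<dots> = z \<bullet> z / (b * b'\<^sup>2)" using b by (simp add: g_def field_simps power2_eq_square)
  finally have "(b - b') * (R' x \<bullet> h) \<le> (b - b') * (z \<bullet> z / (b * b'\<^sup>2))"
    using b by (intro mult_left_mono) auto
  then show "R' x \<bullet> R' x \<le> R' x \<bullet> R x + (b - b') * (z \<bullet> z / (b * b'\<^sup>2))"
    by (subst (2) diff) (simp add: inner_right_distrib)
  have "x \<bullet> h = R' x \<bullet> R x" unfolding h_def by (metis resolvent_symmetric[OF R'])
  then show "x \<bullet> R' x = x \<bullet> R x + (b - b') * (R' x \<bullet> R x)"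
    by (subst diff) (simp add: inner_right_distrib)
qed

text \<open>
  Summed over the family, the error on the complement is at most \<open>(b - b') q / (b b'\<^sup>2)\<close> with
  \<open>q \<ge> N - M card S\<close> the mass outside the span. The second room condition says \<open>M b \<le> (b - b') q\<close>, and
  under it the error is absorbed by the square of the gain \<open>D\<close>. It persists along the iteration, because
  lowering \<open>b\<close> by one step costs the left-hand side just what one more vector costs the right-hand side.\<close>

lemma lower_shift:
  fixes w :: "'i \<Rightarrow> 'a::real_inner" and M b b' :: real
  assumes I: "finite I" and unit: "\<And>i. i \<in> I \<Longrightarrow> w i \<bullet> w i = 1"
    and frame: "\<And>x. (\<Sum>i\<in>I. (w i \<bullet> x)\<^sup>2) \<le> M * (x \<bullet> x)" and M: "M > 0"
    and S: "finite S" and b: "0 < b'" "b' < b" and lb: "gram_above w S b"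
    and R: "resolvent w S b R"
    and room: "M * card S < card I" "M * b \<le> (b - b') * (card I - M * card S)"
  shows "\<exists>R' D. resolvent w S b' R' \<and> D > 0 \<and>
    (\<Sum>i\<in>I. w i \<bullet> R' (w i)) = (\<Sum>i\<in>I. w i \<bullet> R (w i)) + D \<and>
    M * (\<Sum>i\<in>I. R' (w i) \<bullet> R' (w i)) \<le> D * (M / (b - b') + D)"
proof -
  obtain R' where R': "resolvent w S b' R'"
    using resolvent_exists_of_gram_above[OF S b(1) gram_above_mono[OF lb]] b by auto
  obtain P where P: "\<And>x. P x \<in> span (w ` S)" "\<And>x j. j \<in> S \<Longrightarrow> w j \<bullet> (x - P x) = 0"
      "(\<Sum>i\<in>I. w i \<bullet> P (w i)) \<le> M * card S"
    using projection_onto_span[OF S I frame] M by (metis less_imp_le)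
  define d where "d = b - b'"
  have d: "d > 0" using b by (simp add: d_def)
  define z where "z i = w i - P (w i)" for i
  have z: "w j \<bullet> z i = 0" if "j \<in> S" for i j using P(2)[OF that] by (simp add: z_def)
  have split: "P (w i) + z i = w i" for i by (simp add: z_def)
  have pw: "z i \<bullet> z i / (b * b') \<le> R' (w i) \<bullet> R (w i)"
      "R' (w i) \<bullet> R' (w i) \<le> R' (w i) \<bullet> R (w i) + d * (z i \<bullet> z i / (b * b'\<^sup>2))"
      "w i \<bullet> R' (w i) = w i \<bullet> R (w i) + d * (R' (w i) \<bullet> R (w i))" for i
    using lower_shift_pointwise[OF S b lb R R' P(1)[of "w i"], of "z i"] z
    unfolding split d_def by blast+
  define q where "q = (\<Sum>i\<in>I. z i \<bullet> z i)"
  define E where "E = (\<Sum>i\<in>I. R' (w i) \<bullet> R (w i))"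
  have b0: "b > 0" using b by simp
  have zz: "z i \<bullet> z i = w i \<bullet> w i - w i \<bullet> P (w i)" for i
  proof -
    have "v \<bullet> z i = 0" if "v \<in> span (w ` S)" for v
      using that by (induction rule: span_induct_alt) (auto simp: inner_left_distrib P(2) z_def)
    from this[OF P(1)[of "w i"]] show ?thesis
      by (simp add: z_def inner_diff_left inner_diff_right inner_commute)
  qed
  have "q = card I - (\<Sum>i\<in>I. w i \<bullet> P (w i))"
    by (simp add: q_def zz sum_subtractf unit)
  then have q: "card I - M * card S \<le> q" using P(3) by simp
  then have q0: "q > 0" using room(1) by simp
  have Mb: "M * b \<le> d * q" using room(2) q d by (smt (verit) d_def mult_left_mono)
  have E: "q / (b * b') \<le> E"
    unfolding q_def E_def sum_divide_distrib by (intro sum_mono pw)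
  then have E0: "E > 0" using q0 b b0 by (smt (verit) divide_pos_pos mult_pos_pos)
  have "(\<Sum>i\<in>I. R' (w i) \<bullet> R' (w i)) \<le> (\<Sum>i\<in>I. R' (w i) \<bullet> R (w i) + d * (z i \<bullet> z i / (b * b'\<^sup>2)))"
    by (intro sum_mono pw)
  also have "\<dots> = E + d * (q / (b * b'\<^sup>2))"
    by (simp add: E_def q_def sum.distrib sum_distrib_left sum_divide_distrib)
  finally have "M * (\<Sum>i\<in>I. R' (w i) \<bullet> R' (w i)) \<le> M * (E + d * (q / (b * b'\<^sup>2)))"
    using M by simp
  also have "M * (E + d * (q / (b * b'\<^sup>2))) = M * E + (M * b) * (d * q / (b * b')\<^sup>2)"
    using b b0 by (simp add: field_simps power2_eq_square)
  also have "\<dots> \<le> M * E + (d * q) * (d * q / (b * b')\<^sup>2)"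
    using Mb d q0 by (intro add_left_mono mult_right_mono) auto
  also have "(d * q) * (d * q / (b * b')\<^sup>2) = d\<^sup>2 * (q / (b * b'))\<^sup>2"
    by (simp add: power2_eq_square)
  also have "\<dots> \<le> d\<^sup>2 * E\<^sup>2"
    using E q0 b b0 by (intro mult_left_mono power_mono) auto
  also have "M * E + d\<^sup>2 * E\<^sup>2 = (d * E) * (M / d + d * E)"
    using d by (simp add: field_simps power2_eq_square)
  finally have "M * (\<Sum>i\<in>I. R' (w i) \<bullet> R' (w i)) \<le> (d * E) * (M / d + d * E)" by simp
  moreover have "(\<Sum>i\<in>I. w i \<bullet> R' (w i)) = (\<Sum>i\<in>I. w i \<bullet> R (w i)) + d * E"
    unfolding E_def sum_distrib_left sum.distrib[symmetric] by (intro sum.cong refl pw)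
  ultimately show ?thesis
    using R' d E0 by (intro exI[of _ R'] exI[of _ "d * E"]) (auto simp: d_def)
qed

section \<open>Moving the upper barrier\<close>

lemma frame_below_synthesis:
  assumes "frame_below w S t" "t \<ge> 0"
  shows "(\<Sum>j\<in>S. y j *\<^sub>R w j) \<bullet> (\<Sum>j\<in>S. y j *\<^sub>R w j) \<le> t * (\<Sum>j\<in>S. (y j)\<^sup>2)"
proof -
  define z where "z = (\<Sum>j\<in>S. y j *\<^sub>R w j)"
  have "z \<bullet> z = (\<Sum>j\<in>S. y j * (w j \<bullet> z))" by (subst (1) z_def) (rule synthesis_inner)
  then have "(z \<bullet> z)\<^sup>2 \<le> (\<Sum>j\<in>S. (y j)\<^sup>2) * (\<Sum>j\<in>S. (w j \<bullet> z)\<^sup>2)"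
    by (simp add: Cauchy_Schwarz_ineq_sum)
  also have "(\<Sum>j\<in>S. (w j \<bullet> z)\<^sup>2) = frame_op w S z \<bullet> z" by (simp add: frame_op_inner power2_eq_square)
  also have "(\<Sum>j\<in>S. (y j)\<^sup>2) * (frame_op w S z \<bullet> z) \<le> (\<Sum>j\<in>S. (y j)\<^sup>2) * (t * (z \<bullet> z))"
    using frame_belowD[OF assms(1), of z] by (intro mult_left_mono sum_nonneg) auto
  finally have "(z \<bullet> z) * (z \<bullet> z) \<le> (z \<bullet> z) * (t * (\<Sum>j\<in>S. (y j)\<^sup>2))"
    by (simp add: power2_eq_square algebra_simps)
  moreover have "0 \<le> t * (\<Sum>j\<in>S. (y j)\<^sup>2)" using assms(2) by (simp add: sum_nonneg)
  ultimately have "z \<bullet> z \<le> t * (\<Sum>j\<in>S. (y j)\<^sup>2)" by (cases "z = 0") auto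
  then show ?thesis by (simp add: z_def)
qed

lemma resolvent_nonneg_of_frame_below:
  assumes "frame_below w S t" "resolvent w S t R"
  shows "x \<bullet> R x \<ge> 0"
proof -
  have "x \<bullet> R x = t * (R x \<bullet> R x) - frame_op w S (R x) \<bullet> R x"
    using resolvent_right[OF assms(2), of x] by (metis inner_diff_left inner_scaleR_left)
  then show ?thesis using frame_belowD[OF assms(1), of "R x"] by simp
qed

lemma upper_shift_pointwise:
  fixes w :: "'i \<Rightarrow> 'a::real_inner"
  assumes t: "t < t'" and ub: "frame_below w S t"
    and R: "resolvent w S t R" and R': "resolvent w S t' R'"
  shows "R' x \<bullet> R' x \<le> R' x \<bullet> R x"
    and "x \<bullet> R' x = x \<bullet> R x - (t' - t) * (R' x \<bullet> R x)"
proof -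
  define h where "h = R' (R x)"
  have h2: "h = R (R' x)"
  proof -
    have "(t - t') *\<^sub>R R' (R x) = (t - t') *\<^sub>R R (R' x)"
      using resolvent_difference[OF R R', of x] resolvent_difference[OF R' R, of x]
      by (smt (verit) minus_diff_eq scaleR_minus_left)
    then show ?thesis using t by (simp add: h_def)
  qed
  have R'x: "R' x = t *\<^sub>R h - frame_op w S h"
    using resolvent_right[OF R, of "R' x"] h2 by auto
  have diff: "R' x = R x - (t' - t) *\<^sub>R h"
    using resolvent_difference[OF R R', of x] by (simp add: h_def algebra_simps)
  have "R' x \<bullet> h = t * (h \<bullet> h) - frame_op w S h \<bullet> h"
    by (simp add: R'x inner_diff_left)
  then have "R' x \<bullet> h \<ge> 0" using frame_belowD[OF ub, of h] by simp
  then have "(t' - t) * (R' x \<bullet> h) \<ge> 0" using t by simp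
  then show "R' x \<bullet> R' x \<le> R' x \<bullet> R x"
    by (subst (2) diff) (simp add: inner_diff_right)
  have "x \<bullet> h = R' x \<bullet> R x" unfolding h_def by (metis resolvent_symmetric[OF R'])
  then show "x \<bullet> R' x = x \<bullet> R x - (t' - t) * (R' x \<bullet> R x)"
    by (subst diff) (simp add: inner_diff_right)
qed

lemma upper_shift:
  fixes w :: "'i \<Rightarrow> 'a::real_inner" and t t' :: real
  assumes I: "finite I" "I \<noteq> {}" and unit: "\<And>i. i \<in> I \<Longrightarrow> w i \<bullet> w i = 1"
    and S: "finite S" and t: "0 < t" "t < t'" and ub: "frame_below w S t"
    and R: "resolvent w S t R"
  shows "\<exists>R' D. resolvent w S t' R' \<and> D > 0 \<and>
    (\<Sum>i\<in>I. w i \<bullet> R' (w i)) = (\<Sum>i\<in>I. w i \<bullet> R (w i)) - D \<and>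
    (t' - t) * (\<Sum>i\<in>I. R' (w i) \<bullet> R' (w i)) \<le> D"
proof -
  obtain R' where R': "resolvent w S t' R'"
    using resolvent_exists_of_frame_below[OF S _ frame_below_mono[OF ub]] t by fastforce
  note pw = upper_shift_pointwise[OF t(2) ub R R']
  define E where "E = (\<Sum>i\<in>I. R' (w i) \<bullet> R (w i))"
  have "R' (w i) \<bullet> R' (w i) > 0" if "i \<in> I" for i
  proof -
    have "R' (w i) \<noteq> 0"
      using resolvent_right[OF R', of "w i"] unit[OF that]
      by (auto simp: linear_0[OF linear_frame_op])
    then show ?thesis by simp
  qed
  then have "0 < (\<Sum>i\<in>I. R' (w i) \<bullet> R' (w i))" using I by (intro sum_pos) auto
  also have le: "\<dots> \<le> E" unfolding E_def by (intro sum_mono pw)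
  finally have E: "E > 0" .
  have "(\<Sum>i\<in>I. w i \<bullet> R' (w i)) = (\<Sum>i\<in>I. w i \<bullet> R (w i)) - (t' - t) * E"
    unfolding E_def sum_distrib_left sum_subtractf[symmetric] by (intro sum.cong refl pw)
  then show ?thesis
    using R' E le t by (intro exI[of _ R'] exI[of _ "(t' - t) * E"]) auto
qed

section \<open>Choosing a vector\<close>

text \<open>
  An averaging argument. The excess \<open>g\<^sub>i\<close> in the requirement of the lower barrier has sum at
  least \<open>N\<close>, and no single \<open>g\<^sub>i\<close> is larger than \<open>K\<close>; the quantities \<open>U\<^sub>i\<close> of the upper barrier have sum
  at most \<open>2 \<eta> N\<close>. If no index were good for both barriers, then \<open>g\<^sub>i \<le> K U\<^sub>i\<close> for all \<open>i\<close>, which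
  contradicts \<open>2 K \<eta> < 1\<close>.\<close>

lemma choose_vector:
  fixes w :: "'i \<Rightarrow> 'a::real_inner" and M K D E \<eta> :: real
  assumes I: "finite I" "I \<noteq> {}"
    and frame: "\<And>x. (\<Sum>i\<in>I. (w i \<bullet> x)\<^sup>2) \<le> M * (x \<bullet> x)"
    and K: "K > 0" "\<And>i. i \<in> I \<Longrightarrow> w i \<bullet> R (w i) \<le> K"
    and D: "D > 0" "M * (\<Sum>i\<in>I. R (w i) \<bullet> R (w i)) \<le> D * ((\<Sum>i\<in>I. w i \<bullet> R (w i)) - 2 * card I)"
    and Q: "\<And>i. i \<in> I \<Longrightarrow> w i \<bullet> Q (w i) \<ge> 0"
    and E: "E > 0" "M * (\<Sum>i\<in>I. Q (w i) \<bullet> Q (w i)) \<le> E * (\<eta> * card I)"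
    and eta: "(\<Sum>i\<in>I. w i \<bullet> Q (w i)) \<le> \<eta> * card I" "2 * K * \<eta> < 1"
  shows "\<exists>i\<in>I. 1 + (\<Sum>j\<in>I. (w j \<bullet> R (w i))\<^sup>2) / D < w i \<bullet> R (w i) \<and>
    (\<Sum>j\<in>I. (w j \<bullet> Q (w i))\<^sup>2) / E + w i \<bullet> Q (w i) < 1"
proof (rule ccontr)
  assume contra: "\<not> ?thesis"
  define g where "g i = w i \<bullet> R (w i) - 1 - (\<Sum>j\<in>I. (w j \<bullet> R (w i))\<^sup>2) / D" for i
  define U where "U i = (\<Sum>j\<in>I. (w j \<bullet> Q (w i))\<^sup>2) / E + w i \<bullet> Q (w i)" for i
  have N: "real (card I) > 0" using I by (simp add: card_gt_0_iff)
  have avg: "(\<Sum>i\<in>I. (\<Sum>j\<in>I. (w j \<bullet> T (w i))\<^sup>2)) \<le> M * (\<Sum>i\<in>I. T (w i) \<bullet> T (w i))" for T :: "'a \<Rightarrow> 'a"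
    unfolding sum_distrib_left by (intro sum_mono frame)
  have le: "g i \<le> K * U i" if i: "i \<in> I" for i
  proof (cases "U i < 1")
    case True
    then have "\<not> 1 + (\<Sum>j\<in>I. (w j \<bullet> R (w i))\<^sup>2) / D < w i \<bullet> R (w i)"
      using contra i unfolding U_def by blast
    then have "g i \<le> 0" by (simp add: g_def)
    moreover have "U i \<ge> 0" unfolding U_def using Q[OF i] E by (simp add: sum_nonneg)
    ultimately show ?thesis using K(1) by (smt (verit) mult_nonneg_nonneg)
  next
    case False
    have "(\<Sum>j\<in>I. (w j \<bullet> R (w i))\<^sup>2) / D \<ge> 0" using D by (simp add: sum_nonneg)
    then have "g i \<le> K" using K(2)[OF i] unfolding g_def by linarith
    also have "\<dots> \<le> K * U i" using False K(1) by simp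
    finally show ?thesis .
  qed
  have "(\<Sum>i\<in>I. (\<Sum>j\<in>I. (w j \<bullet> R (w i))\<^sup>2)) / D \<le> (\<Sum>i\<in>I. w i \<bullet> R (w i)) - 2 * card I"
    using avg[of R] D by (simp add: divide_le_eq mult.commute)
  then have "card I \<le> (\<Sum>i\<in>I. g i)"
    by (simp add: g_def sum_subtractf sum_divide_distrib)
  also have "\<dots> \<le> (\<Sum>i\<in>I. K * U i)" by (intro sum_mono le)
  also have "\<dots> = K * ((\<Sum>i\<in>I. (\<Sum>j\<in>I. (w j \<bullet> Q (w i))\<^sup>2)) / E + (\<Sum>i\<in>I. w i \<bullet> Q (w i)))"
    by (simp add: U_def sum.distrib sum_distrib_left sum_divide_distrib distrib_left)
  also have "\<dots> \<le> K * (\<eta> * card I + \<eta> * card I)"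
    using avg[of Q] E eta(1) K(1) by (intro mult_left_mono add_mono) (auto simp: divide_le_eq mult.commute)
  also have "\<dots> = (2 * K * \<eta>) * card I" by simp
  also have "\<dots> < 1 * real (card I)" using eta(2) N by (intro mult_strict_right_mono) auto
  finally show False by simp
qed

text \<open>The upper barrier moves from \<open>t\<close> to \<open>t'\<close> here, whereas the lower barrier stays at \<open>b\<close>, and its potential may
  drop by the amount \<open>D\<close>. This serves two purposes: during the iteration \<open>D\<close> is what
  \<open>lower_shift\<close> has just gained, and for the last vector \<open>D\<close> may be taken as large as desired.\<close>

lemma extend_selection:
  fixes w :: "'i \<Rightarrow> 'a::real_inner" and M K D b t t' \<eta> :: real
  assumes I: "finite I" "I \<noteq> {}" and unit: "\<And>i. i \<in> I \<Longrightarrow> w i \<bullet> w i = 1"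
    and frame: "\<And>x. (\<Sum>i\<in>I. (w i \<bullet> x)\<^sup>2) \<le> M * (x \<bullet> x)"
    and S: "S \<subseteq> I" and b: "b > 0" "1 / b \<le> K"
    and lb: "gram_above w S b" and R: "resolvent w S b R"
    and D: "D > 0" "M * (\<Sum>i\<in>I. R (w i) \<bullet> R (w i)) \<le> D * ((\<Sum>i\<in>I. w i \<bullet> R (w i)) - 2 * card I)"
    and t: "t > 0" "t < t'" and ub: "frame_below w S t" and Q: "resolvent w S t Q"
    and eta: "(\<Sum>i\<in>I. w i \<bullet> Q (w i)) \<le> \<eta> * card I" "M \<le> (t' - t) * (\<eta> * card I)" "2 * K * \<eta> < 1"
  shows "\<exists>i\<in>I - S. gram_above w (insert i S) b \<and> frame_below w (insert i S) t' \<and>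
    (\<exists>R'. resolvent w (insert i S) b R' \<and> (\<Sum>j\<in>I. w j \<bullet> R (w j)) - D \<le> (\<Sum>j\<in>I. w j \<bullet> R' (w j))) \<and>
    (\<exists>Q'. resolvent w (insert i S) t' Q' \<and> (\<Sum>j\<in>I. w j \<bullet> Q' (w j)) \<le> (\<Sum>j\<in>I. w j \<bullet> Q (w j)))"
proof -
  have finS: "finite S" using S I(1) finite_subset by blast
  obtain T E where T: "resolvent w S t' T" and E: "E > 0"
      and TE: "(\<Sum>i\<in>I. w i \<bullet> T (w i)) = (\<Sum>i\<in>I. w i \<bullet> Q (w i)) - E"
      and TT: "(t' - t) * (\<Sum>i\<in>I. T (w i) \<bullet> T (w i)) \<le> E"
    using upper_shift[OF I unit finS t ub Q] by blast
  have ub': "frame_below w S t'" using frame_below_mono[OF ub] t by simp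
  have N: "real (card I) > 0" using I by (simp add: card_gt_0_iff)
  have Tnn: "w i \<bullet> T (w i) \<ge> 0" for i by (rule resolvent_nonneg_of_frame_below[OF ub' T])
  have Qnn: "w i \<bullet> Q (w i) \<ge> 0" for i by (rule resolvent_nonneg_of_frame_below[OF ub Q])
  have "0 \<le> (\<Sum>i\<in>I. w i \<bullet> Q (w i))" by (intro sum_nonneg Qnn)
  then have eta0: "0 \<le> \<eta> * card I" using eta(1) by linarith
  have "M * (\<Sum>i\<in>I. T (w i) \<bullet> T (w i)) \<le> ((t' - t) * (\<eta> * card I)) * (\<Sum>i\<in>I. T (w i) \<bullet> T (w i))"
    using eta(2) by (intro mult_right_mono sum_nonneg) auto
  also have "\<dots> = ((t' - t) * (\<Sum>i\<in>I. T (w i) \<bullet> T (w i))) * (\<eta> * card I)" by simp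
  also have "\<dots> \<le> E * (\<eta> * card I)" using TT eta0 by (rule mult_right_mono)
  finally have ET: "M * (\<Sum>i\<in>I. T (w i) \<bullet> T (w i)) \<le> E * (\<eta> * card I)" .
  have K0: "K > 0" using b by (smt (verit) divide_pos_pos)
  have RK: "w i \<bullet> R (w i) \<le> K" if "i \<in> I" for i
    using resolvent_le_of_gram_above[OF b(1) lb R, of "w i"] unit[OF that] b(2) by simp
  have etaT: "(\<Sum>i\<in>I. w i \<bullet> T (w i)) \<le> \<eta> * card I" using TE E eta(1) by linarith
  obtain i where i: "i \<in> I"
      and s: "1 + (\<Sum>j\<in>I. (w j \<bullet> R (w i))\<^sup>2) / D < w i \<bullet> R (w i)"
      and u: "(\<Sum>j\<in>I. (w j \<bullet> T (w i))\<^sup>2) / E + w i \<bullet> T (w i) < 1"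
    using choose_vector[where R = R and Q = T, OF I frame K0 RK D Tnn E ET etaT eta(3)] by blast
  define r where "r = (\<Sum>j\<in>I. (w j \<bullet> R (w i))\<^sup>2)"
  define q where "q = (\<Sum>j\<in>I. (w j \<bullet> T (w i))\<^sup>2)"
  have rq: "r \<ge> 0" "q \<ge> 0" unfolding r_def q_def by (auto intro: sum_nonneg)
  have s1: "w i \<bullet> R (w i) > 1" using s rq D(1) unfolding r_def[symmetric]
    by (smt (verit) divide_nonneg_pos)
  have u1: "w i \<bullet> T (w i) < 1" using u rq E unfolding q_def[symmetric]
    by (smt (verit) divide_nonneg_pos)
  have iS: "i \<notin> S"
  proof
    assume "i \<in> S"
    then have "w i \<in> span (w ` S)" by (intro span_base) auto
    then show False using resolvent_nonpos_on_span[OF finS b(1) lb R, of "w i"] s1 by simp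
  qed
  obtain R' where R': "resolvent w (insert i S) b R'"
      "(\<Sum>j\<in>I. w j \<bullet> R' (w j)) = (\<Sum>j\<in>I. w j \<bullet> R (w j)) + r / (1 - w i \<bullet> R (w i))"
    using potential_insert[OF R finS iS, of I] s1 unfolding r_def by auto
  obtain T' where T': "resolvent w (insert i S) t' T'"
      "(\<Sum>j\<in>I. w j \<bullet> T' (w j)) = (\<Sum>j\<in>I. w j \<bullet> T (w j)) + q / (1 - w i \<bullet> T (w i))"
    using potential_insert[OF T finS iS, of I] u1 unfolding q_def by auto
  have "r < D * (w i \<bullet> R (w i) - 1)"
    using s D(1) unfolding r_def[symmetric] by (simp add: field_simps)
  then have "- D \<le> r / (1 - w i \<bullet> R (w i))"
    using s1 by (simp add: le_divide_eq algebra_simps)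
  moreover have "q < E * (1 - w i \<bullet> T (w i))"
    using u E unfolding q_def[symmetric] by (simp add: field_simps)
  then have "q / (1 - w i \<bullet> T (w i)) \<le> E"
    using u1 by (simp add: divide_le_eq algebra_simps)
  moreover have "gram_above w (insert i S) b"
    using gram_above_insert_iff[OF R finS iS b(1) lb] s1 by simp
  moreover have "frame_below w (insert i S) t'"
    using frame_below_insert_iff[OF T finS iS ub'] u1 by simp
  ultimately show ?thesis
    using R' T' TE i iS by (intro bexI[of _ i] conjI exI[of _ R'] exI[of _ T']) (simp, simp, simp, linarith, simp, linarith, simp)
qed

section \<open>Selecting a large part of the family\<close>

text \<open>
  The lower barrier starts at \<open>b\<^sub>0 = (1 - e/2) \<tau>\<close> with \<open>\<tau> = e/4\<close> and moves by \<open>\<tau> M/N\<close> in each step.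
  In \<open>(1 - e) N/M\<close> steps it loses at most \<open>(1 - e) \<tau>\<close>, so it stays above
  \<open>\<tau> e/2 = e\<^sup>2/8\<close>. The choice of \<open>\<tau>\<close> ensures \<open>1/b\<^sub>0 \<ge> 1/\<tau> + 2\<close>: an initial potential \<open>N/b\<^sub>0\<close> is
  enough for the term \<open>M/(b - b') = N/\<tau>\<close> of \<open>lower_shift\<close> and the margin \<open>2 N\<close> of
  \<open>choose_vector\<close>. The constant \<open>32/e\<^sup>2\<close> makes \<open>\<eta> = e\<^sup>2/32\<close> small against \<open>1/K = e\<^sup>2/8\<close>.\<close>

lemma barrier_iteration:
  fixes w :: "'i \<Rightarrow> 'a::real_inner" and M e :: real and b t :: "nat \<Rightarrow> real" and k :: nat
  assumes e: "0 < e" "e \<le> 1/2"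
    and I: "finite I" "I \<noteq> {}" and unit: "\<And>i. i \<in> I \<Longrightarrow> w i \<bullet> w i = 1"
    and frame: "\<And>x. (\<Sum>i\<in>I. (w i \<bullet> x)\<^sup>2) \<le> M * (x \<bullet> x)" and M: "M > 0"
    and k: "k * M \<le> (1 - e) * card I"
  defines "b \<equiv> (\<lambda>k. (1 - e/2) * (e/4) - k * (e/4 * M / card I))"
    and "t \<equiv> (\<lambda>k. 32 / e\<^sup>2 * (1 + k * M / card I))"
  shows "\<exists>S\<subseteq>I. card S = k \<and> gram_above w S (b k) \<and> frame_below w S (t k) \<and>
    (\<exists>R. resolvent w S (b k) R \<and> card I / ((1 - e/2) * (e/4)) \<le> (\<Sum>i\<in>I. w i \<bullet> R (w i))) \<and>
    (\<exists>Q. resolvent w S (t k) Q \<and> (\<Sum>i\<in>I. w i \<bullet> Q (w i)) \<le> e\<^sup>2/32 * card I)"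
  using k
proof (induction k)
  case 0
  have N: "real (card I) > 0" using I by (simp add: card_gt_0_iff)
  have b0: "b 0 = (1 - e/2) * (e/4)" by (simp add: b_def)
  have t0: "t 0 = 32 / e\<^sup>2" by (simp add: t_def)
  have b0_pos: "b 0 > 0" using e by (simp add: b0)
  have t0_pos: "t 0 > 0" using e by (simp add: t0)
  have initial: "(\<Sum>i\<in>I. w i \<bullet> (w i /\<^sub>R c)) = card I / c" for c
    by (simp add: unit field_simps cong: sum.cong_simp)
  have "{} \<subseteq> I" "card {} = (0::nat)" by auto
  moreover have "\<exists>R. resolvent w {} (b 0) R \<and>
      card I / ((1 - e/2) * (e/4)) \<le> (\<Sum>i\<in>I. w i \<bullet> R (w i))"
  proof (intro exI conjI)
    show "resolvent w {} (b 0) (\<lambda>x. x /\<^sub>R b 0)" using b0_pos by (intro resolvent_empty) simp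
  qed (simp only: initial b0 order_refl)
  moreover have "\<exists>Q. resolvent w {} (t 0) Q \<and> (\<Sum>i\<in>I. w i \<bullet> Q (w i)) \<le> e\<^sup>2/32 * card I"
  proof (intro exI conjI)
    show "resolvent w {} (t 0) (\<lambda>x. x /\<^sub>R t 0)" using t0_pos by (intro resolvent_empty) simp
    show "(\<Sum>i\<in>I. w i \<bullet> (w i /\<^sub>R t 0)) \<le> e\<^sup>2/32 * card I"
      unfolding initial t0 by simp
  qed
  moreover have "gram_above w {} (b 0)" by (simp add: gram_above_def)
  moreover have "frame_below w {} (t 0)" using t0_pos by (simp add: frame_below_def frame_op_def)
  ultimately show ?case by (intro exI[of _ "{}"]) blast
next
  case (Suc k)
  define N where "N = real (card I)"
  have N: "N > 0" using I by (simp add: card_gt_0_iff N_def)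
  define \<tau> where "\<tau> = e/4"
  define d where "d = \<tau> * M / N"
  define b\<^sub>0 where "b\<^sub>0 = (1 - e/2) * \<tau>"
  have tau: "\<tau> > 0" using e by (simp add: \<tau>_def)
  have d: "d > 0" using tau M N by (simp add: d_def)
  have kM: "(real k + 1) * M \<le> (1 - e) * N" using Suc.prems by (simp add: N_def algebra_simps)
  have kM': "k * M \<le> (1 - e) * N" using kM M by (simp add: algebra_simps)
  obtain S R Q where S: "S \<subseteq> I" "card S = k" and lb: "gram_above w S (b k)"
      and ub: "frame_below w S (t k)" and R: "resolvent w S (b k) R"
      and RN: "N / b\<^sub>0 \<le> (\<Sum>i\<in>I. w i \<bullet> R (w i))"
      and Q: "resolvent w S (t k) Q" and QN: "(\<Sum>i\<in>I. w i \<bullet> Q (w i)) \<le> e\<^sup>2/32 * N"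
    using Suc.IH kM' unfolding N_def b\<^sub>0_def \<tau>_def by blast
  have finS: "finite S" using S I(1) finite_subset by blast
  have bk: "b j = b\<^sub>0 - j * d" for j by (simp add: b_def b\<^sub>0_def d_def \<tau>_def N_def)
  have bdiff: "b k - b (Suc k) = d" by (simp add: bk algebra_simps)
  have kd: "(real k + 1) * d \<le> (1 - e) * \<tau>"
  proof -
    have "(real k + 1) * d = \<tau> / N * ((real k + 1) * M)" by (simp add: d_def)
    also have "\<dots> \<le> \<tau> / N * ((1 - e) * N)" using kM tau N by (intro mult_left_mono) auto
    finally show ?thesis using N by (simp add: mult.commute)
  qed
  have bSuc: "e\<^sup>2 / 8 \<le> b (Suc k)"
    using kd by (simp add: bk b\<^sub>0_def \<tau>_def power2_eq_square field_simps)
  have e2: "0 < e\<^sup>2" using e by simp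
  have pos: "0 < b (Suc k)" using bSuc e2 by linarith
  have room1: "M * card S < card I"
  proof -
    have "M * k < (real k + 1) * M" using M by simp
    also have "\<dots> \<le> N" using kM e N by (smt (verit) mult_left_le_one_le mult_le_cancel_right2)
    finally show ?thesis by (simp add: S N_def)
  qed
  have room2: "M * b k \<le> (b k - b (Suc k)) * (card I - M * card S)"
  proof -
    have "d * (N - M * k) = M * (\<tau> - k * d)" using N by (simp add: d_def field_simps)
    moreover have "b k \<le> \<tau> - k * d" using e tau by (simp add: bk b\<^sub>0_def field_simps)
    ultimately show ?thesis using M by (simp add: bdiff S N_def)
  qed
  have lt: "b (Suc k) < b k" using bdiff d by linarith
  obtain R' D where R': "resolvent w S (b (Suc k)) R'" and D: "D > 0"
      and R'D: "(\<Sum>i\<in>I. w i \<bullet> R' (w i)) = (\<Sum>i\<in>I. w i \<bullet> R (w i)) + D"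
      and shift: "M * (\<Sum>i\<in>I. R' (w i) \<bullet> R' (w i)) \<le> D * (M / d + D)"
    using lower_shift[OF I(1) unit frame M finS pos lt lb R room1 room2] unfolding bdiff by blast
  have "M / d + 2 * N \<le> N / b\<^sub>0"
  proof -
    have "M / d = N / \<tau>" using M N tau by (simp add: d_def)
    moreover have "1 / \<tau> + 2 \<le> 1 / b\<^sub>0"
    proof -
      have "(1 / \<tau> + 2) * b\<^sub>0 = (1 - e/2) * (1 + e/2)" using e by (simp add: b\<^sub>0_def \<tau>_def field_simps)
      also have "\<dots> \<le> 1" by (simp add: field_simps)
      finally show ?thesis using e tau by (simp add: b\<^sub>0_def le_divide_eq)
    qed
    ultimately show ?thesis using mult_left_mono[of "1 / \<tau> + 2" "1 / b\<^sub>0" N] N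
      by (simp add: distrib_left)
  qed
  then have "D * (M / d + D) \<le> D * ((\<Sum>i\<in>I. w i \<bullet> R' (w i)) - 2 * N)"
    using RN D R'D by (intro mult_left_mono) auto
  with shift have shift': "M * (\<Sum>i\<in>I. R' (w i) \<bullet> R' (w i)) \<le> D * ((\<Sum>i\<in>I. w i \<bullet> R' (w i)) - 2 * card I)"
    by (simp add: N_def)
  have tdiff: "t (Suc k) - t k = 32 / e\<^sup>2 * (M / N)"
    unfolding t_def N_def[symmetric] by (simp add: algebra_simps add_divide_distrib)
  have "32 / e\<^sup>2 * (M / N) > 0" using e2 M N by simp
  then have tlt: "t k < t (Suc k)" using tdiff by linarith
  have tpos: "t k > 0" unfolding t_def N_def[symmetric] using e2 M N
    by (intro mult_pos_pos add_pos_nonneg divide_nonneg_pos mult_nonneg_nonneg) auto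
  have "32 / e\<^sup>2 * (M / N) * (e\<^sup>2/32 * N) = M" using e N by simp
  then have eta: "M \<le> (t (Suc k) - t k) * (e\<^sup>2/32 * card I)"
    unfolding tdiff N_def by linarith
  have K: "1 / b (Suc k) \<le> 8 / e\<^sup>2"
    using frac_le[of 1 1 "e\<^sup>2 / 8" "b (Suc k)"] bSuc e2 by simp
  have "2 * (8 / e\<^sup>2) * (e\<^sup>2 / 32) < 1" using e by simp
  from extend_selection[OF I unit frame S(1) pos K gram_above_mono[OF lb less_imp_le[OF lt]] R' D
      shift' tpos tlt ub Q QN[unfolded N_def] eta this]
  obtain i where i: "i \<in> I - S" and new: "gram_above w (insert i S) (b (Suc k))"
      "frame_below w (insert i S) (t (Suc k))"
      "\<exists>R''. resolvent w (insert i S) (b (Suc k)) R'' \<and>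
        (\<Sum>j\<in>I. w j \<bullet> R' (w j)) - D \<le> (\<Sum>j\<in>I. w j \<bullet> R'' (w j))"
      "\<exists>Q'. resolvent w (insert i S) (t (Suc k)) Q' \<and> (\<Sum>j\<in>I. w j \<bullet> Q' (w j)) \<le> (\<Sum>j\<in>I. w j \<bullet> Q (w j))"
    by blast
  show ?case
  proof (intro exI[of _ "insert i S"] conjI)
    show "insert i S \<subseteq> I" "card (insert i S) = Suc k" using i S finS by auto
    show "\<exists>R. resolvent w (insert i S) (b (Suc k)) R \<and>
        card I / ((1 - e/2) * (e/4)) \<le> (\<Sum>i\<in>I. w i \<bullet> R (w i))"
      using new(3) RN R'D unfolding N_def b\<^sub>0_def \<tau>_def by fastforce
    show "\<exists>Q. resolvent w (insert i S) (t (Suc k)) Q \<and> (\<Sum>i\<in>I. w i \<bullet> Q (w i)) \<le> e\<^sup>2/32 * card I"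
      using new(4) QN unfolding N_def by fastforce
  qed (use new in auto)
qed

text \<open>
  After \<open>k = \<lfloor>(1 - e) N/M\<rfloor>\<close> steps of the iteration one more vector is adjoined with the lower
  barrier left in place; lowering it again could make it negative when \<open>N/M\<close> is bounded. The upper
  barrier ends below \<open>96/e\<^sup>2\<close> as soon as \<open>M \<le> N\<close>, which is no restriction, because unit vectors satisfy the
  frame bound with \<open>N\<close> in place of \<open>M\<close>.\<close>

theorem well_conditioned_subfamily:
  fixes w :: "'i \<Rightarrow> 'a::real_inner" and M e :: real
  assumes e: "0 < e" "e \<le> 1/2"
    and I: "finite I" "I \<noteq> {}" and unit: "\<And>i. i \<in> I \<Longrightarrow> w i \<bullet> w i = 1"
    and frame: "\<And>x. (\<Sum>i\<in>I. (w i \<bullet> x)\<^sup>2) \<le> M * (x \<bullet> x)"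
  shows "\<exists>S\<subseteq>I. (1 - e) * (card I / M) < card S \<and> (\<forall>y.
    e\<^sup>2/8 * (\<Sum>j\<in>S. (y j)\<^sup>2) \<le> (\<Sum>j\<in>S. y j *\<^sub>R w j) \<bullet> (\<Sum>j\<in>S. y j *\<^sub>R w j) \<and>
    (\<Sum>j\<in>S. y j *\<^sub>R w j) \<bullet> (\<Sum>j\<in>S. y j *\<^sub>R w j) \<le> 96/e\<^sup>2 * (\<Sum>j\<in>S. (y j)\<^sup>2))"
proof -
  define N where "N = real (card I)"
  have N: "N > 0" using I by (simp add: card_gt_0_iff N_def)
  obtain i\<^sub>0 where i0: "i\<^sub>0 \<in> I" using I by blast
  have "1 = (w i\<^sub>0 \<bullet> w i\<^sub>0)\<^sup>2" by (simp add: unit i0)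
  also have "\<dots> \<le> (\<Sum>i\<in>I. (w i \<bullet> w i\<^sub>0)\<^sup>2)"
    by (rule member_le_sum[OF i0]) (use I in auto)
  also have "\<dots> \<le> M" using frame[of "w i\<^sub>0"] by (simp add: unit i0)
  finally have M1: "1 \<le> M" .
  define m where "m = min M N"
  have m: "m > 0" "m \<le> N" "m \<le> M" using M1 N by (auto simp: m_def)
  have frame_m: "(\<Sum>i\<in>I. (w i \<bullet> x)\<^sup>2) \<le> m * (x \<bullet> x)" for x
  proof -
    have "(w i \<bullet> x)\<^sup>2 \<le> x \<bullet> x" if "i \<in> I" for i
      using Cauchy_Schwarz_ineq[of "w i" x] unit[OF that] by simp
    then have "(\<Sum>i\<in>I. (w i \<bullet> x)\<^sup>2) \<le> N * (x \<bullet> x)"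
      using sum_bounded_above[of I "\<lambda>i. (w i \<bullet> x)\<^sup>2" "x \<bullet> x"] by (simp add: N_def)
    then show ?thesis using frame[of x] by (simp add: m_def min_def)
  qed
  define k where "k = nat \<lfloor>(1 - e) * N / m\<rfloor>"
  have "(1 - e) * N / m \<ge> 0" using e N m by simp
  then have k: "real k \<le> (1 - e) * N / m" "(1 - e) * N / m < real k + 1"
    by (auto simp: k_def)
  have km: "k * m \<le> (1 - e) * card I" using k(1) m by (simp add: field_simps N_def)
  define d where "d = e/4 * m / N"
  define b\<^sub>0 where "b\<^sub>0 = (1 - e/2) * (e/4)"
  define b where "b = b\<^sub>0 - k * d"
  define t where "t j = 32 / e\<^sup>2 * (1 + j * m / N)" for j :: nat
  obtain S R Q where S: "S \<subseteq> I" "card S = k" and lb: "gram_above w S b"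
      and ub: "frame_below w S (t k)" and R: "resolvent w S b R"
      and RN: "N / b\<^sub>0 \<le> (\<Sum>i\<in>I. w i \<bullet> R (w i))"
      and Q: "resolvent w S (t k) Q" and QN: "(\<Sum>i\<in>I. w i \<bullet> Q (w i)) \<le> e\<^sup>2/32 * card I"
    using barrier_iteration[OF e I unit frame_m m(1) km]
    unfolding N_def[symmetric] b_def b\<^sub>0_def d_def t_def by blast
  have e2: "0 < e\<^sup>2" using e by simp
  have b: "e\<^sup>2/8 \<le> b"
  proof -
    have "k * d = e/4 / N * (k * m)" by (simp add: d_def)
    also have "\<dots> \<le> e/4 / N * ((1 - e) * N)" using km e N unfolding N_def by (intro mult_left_mono) auto
    also have "\<dots> = e/4 * (1 - e)" using N by simp
    finally show ?thesis by (simp add: b_def b\<^sub>0_def power2_eq_square field_simps)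
  qed
  then have pos: "b > 0" using e2 by linarith
  have K: "1 / b \<le> 8 / e\<^sup>2"
    using frac_le[of 1 1 "e\<^sup>2 / 8" b] b e2 by simp
  have "2 * N < N / b\<^sub>0"
  proof -
    have "b\<^sub>0 > 0" using e by (simp add: b\<^sub>0_def)
    moreover have "b\<^sub>0 \<le> 1 * (1/8)" unfolding b\<^sub>0_def using e by (intro mult_mono) auto
    ultimately show ?thesis using N by (simp add: field_simps)
  qed
  then have gap: "(\<Sum>i\<in>I. w i \<bullet> R (w i)) - 2 * N > 0" using RN by linarith
  define r where "r = m * (\<Sum>i\<in>I. R (w i) \<bullet> R (w i))"
  \<comment> \<open>The summand 1 keeps \<open>D\<close> positive.\<close>
  define D where "D = r / ((\<Sum>i\<in>I. w i \<bullet> R (w i)) - 2 * N) + 1"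
  have r: "r \<ge> 0" using m by (simp add: r_def sum_nonneg)
  have D: "D > 0" using r gap by (simp add: D_def add_nonneg_pos)
  have "r \<le> D * ((\<Sum>i\<in>I. w i \<bullet> R (w i)) - 2 * N)"
    using gap by (simp add: D_def distrib_right)
  then have D': "m * (\<Sum>i\<in>I. R (w i) \<bullet> R (w i)) \<le> D * ((\<Sum>i\<in>I. w i \<bullet> R (w i)) - 2 * card I)"
    by (simp add: r_def N_def)
  have tdiff: "t (k + 1) - t k = 32 / e\<^sup>2 * (m / N)"
    by (simp add: t_def add_divide_distrib distrib_right distrib_left)
  have "32 / e\<^sup>2 * (m / N) > 0" using e2 m N by simp
  then have tlt: "t k < t (k + 1)" using tdiff by linarith
  have tpos: "t k > 0" unfolding t_def using e2 m N
    by (intro mult_pos_pos add_pos_nonneg divide_nonneg_pos mult_nonneg_nonneg) auto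
  have eta: "m \<le> (t (k + 1) - t k) * (e\<^sup>2/32 * card I)"
    unfolding tdiff N_def[symmetric] using e N by simp
  have "2 * (8 / e\<^sup>2) * (e\<^sup>2 / 32) < 1" using e by simp
  from extend_selection[OF I unit frame_m S(1) pos K lb R D D' tpos tlt ub Q QN eta this]
  obtain i where i: "i \<in> I - S" and new: "gram_above w (insert i S) b"
      "frame_below w (insert i S) (t (k + 1))"
    by blast
  have t96: "t (k + 1) \<le> 96 / e\<^sup>2"
  proof -
    have "(real k + 1) * m \<le> (1 - e) * N + m" using km by (simp add: N_def algebra_simps)
    also have "\<dots> \<le> 2 * N" using m e N by (smt (verit) mult_le_cancel_right2)
    finally have "(real k + 1) * m / N \<le> 2" using N by (simp add: divide_le_eq)
    then have "32 / e\<^sup>2 * (1 + (real k + 1) * m / N) \<le> 32 / e\<^sup>2 * 3"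
      using e2 by (intro mult_left_mono) auto
    then show ?thesis by (simp add: t_def add.commute)
  qed
  have "(1 - e) * (N / M) \<le> (1 - e) * N / m"
    using m e N by (simp add: frac_le mult_left_mono)
  also have "\<dots> < card (insert i S)" using k(2) S i finite_subset[OF S(1) I(1)] by simp
  finally have "(1 - e) * (card I / M) < card (insert i S)" by (simp add: N_def)
  then show ?thesis
    using i S(1) gram_aboveD[OF gram_above_mono[OF new(1) b]]
      frame_below_synthesis[OF frame_below_mono[OF new(2) t96]] e2
    by (intro exI[of _ "insert i S"]) auto
qed

section \<open>Finitely supported sequences as an inner product space\<close>

instantiation poly_mapping :: (type, real_vector) real_vector
begin

lift_definition scaleR_poly_mapping :: "real \<Rightarrow> ('a \<Rightarrow>\<^sub>0 'b) \<Rightarrow> ('a \<Rightarrow>\<^sub>0 'b)"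
  is "\<lambda>r f k. r *\<^sub>R f k"
  by (rule finite_subset[rotated]) auto

instance
  by standard (transfer; simp add: fun_eq_iff scaleR_add_left scaleR_add_right)+

end

instantiation poly_mapping :: (type, real_inner) real_inner
begin

definition inner_poly_mapping :: "('a \<Rightarrow>\<^sub>0 'b) \<Rightarrow> ('a \<Rightarrow>\<^sub>0 'b) \<Rightarrow> real" where
  "inner_poly_mapping f g = (\<Sum>k\<in>Poly_Mapping.keys f. Poly_Mapping.lookup f k \<bullet> Poly_Mapping.lookup g k)"

definition norm_poly_mapping :: "('a \<Rightarrow>\<^sub>0 'b) \<Rightarrow> real" where
  "norm_poly_mapping f = sqrt (f \<bullet> f)"

definition dist_poly_mapping :: "('a \<Rightarrow>\<^sub>0 'b) \<Rightarrow> ('a \<Rightarrow>\<^sub>0 'b) \<Rightarrow> real" where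
  "dist_poly_mapping f g = norm (f - g)"

definition sgn_poly_mapping :: "('a \<Rightarrow>\<^sub>0 'b) \<Rightarrow> ('a \<Rightarrow>\<^sub>0 'b)" where
  "sgn_poly_mapping f = f /\<^sub>R norm f"

definition uniformity_poly_mapping :: "(('a \<Rightarrow>\<^sub>0 'b) \<times> ('a \<Rightarrow>\<^sub>0 'b)) filter" where
  "uniformity_poly_mapping = (INF e\<in>{0<..}. principal {(x, y). dist x y < e})"

definition open_poly_mapping :: "('a \<Rightarrow>\<^sub>0 'b) set \<Rightarrow> bool" where
  "open_poly_mapping U \<longleftrightarrow> (\<forall>x\<in>U. eventually (\<lambda>(x', y). x' = x \<longrightarrow> y \<in> U) uniformity)"

lemma inner_poly_mapping_superset:
  fixes f g :: "'a \<Rightarrow>\<^sub>0 'b"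
  assumes "finite A" "Poly_Mapping.keys f \<subseteq> A"
  shows "f \<bullet> g = (\<Sum>k\<in>A. Poly_Mapping.lookup f k \<bullet> Poly_Mapping.lookup g k)"
  unfolding inner_poly_mapping_def using assms
  by (intro sum.mono_neutral_left) (auto simp: in_keys_iff)

instance
proof
  fix f g h :: "'a \<Rightarrow>\<^sub>0 'b" and r :: real and U :: "('a \<Rightarrow>\<^sub>0 'b) set"
  define A where "A = Poly_Mapping.keys f \<union> Poly_Mapping.keys g \<union> Poly_Mapping.keys h"
  have A: "finite A" "Poly_Mapping.keys f \<subseteq> A" "Poly_Mapping.keys g \<subseteq> A" "Poly_Mapping.keys h \<subseteq> A" "Poly_Mapping.keys (f + g) \<subseteq> A" "Poly_Mapping.keys (r *\<^sub>R f) \<subseteq> A"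
    using keys_add[of f g] by (auto simp: A_def in_keys_iff scaleR_poly_mapping.rep_eq)
  note sup = inner_poly_mapping_superset[OF A(1)]
  show "dist f g = norm (f - g)" by (rule dist_poly_mapping_def)
  show "sgn f = f /\<^sub>R norm f" by (rule sgn_poly_mapping_def)
  show "uniformity = (INF e\<in>{0<..}. principal {(x :: 'a \<Rightarrow>\<^sub>0 'b, y). dist x y < e})"
    by (rule uniformity_poly_mapping_def)
  show "open U \<longleftrightarrow> (\<forall>x\<in>U. eventually (\<lambda>(x', y). x' = x \<longrightarrow> y \<in> U) uniformity)"
    by (rule open_poly_mapping_def)
  show "norm f = sqrt (f \<bullet> f)" by (rule norm_poly_mapping_def)
  show "f \<bullet> g = g \<bullet> f" by (simp add: sup A inner_commute)
  show "(f + g) \<bullet> h = f \<bullet> h + g \<bullet> h"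
    by (simp add: sup A lookup_add inner_left_distrib sum.distrib)
  show "(r *\<^sub>R f) \<bullet> g = r * (f \<bullet> g)"
    by (simp add: sup A scaleR_poly_mapping.rep_eq sum_distrib_left)
  show "0 \<le> f \<bullet> f" by (simp add: inner_poly_mapping_def sum_nonneg)
  show "(f \<bullet> f = 0) = (f = 0)"
    by (auto simp: inner_poly_mapping_def sum_nonneg_eq_0_iff in_keys_iff)
      (metis in_keys_iff lookup_zero poly_mapping_eqI)
qed

end

section \<open>Operators on Euclidean spaces of variable dimension\<close>

text \<open>Extension by zero embeds every \<open>\<ell>\<^sub>2\<^sup>N\<close> isometrically into one and the same space.\<close>

definition sequence_of_vec :: "real vec \<Rightarrow> nat \<Rightarrow>\<^sub>0 real" where
  "sequence_of_vec v = Abs_poly_mapping (\<lambda>k. if k < dim_vec v then v $ k else 0)"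

lemma lookup_sequence_of_vec: "Poly_Mapping.lookup (sequence_of_vec v) k = (if k < dim_vec v then v $ k else 0)"
  unfolding sequence_of_vec_def
  by (subst Abs_poly_mapping_inverse) (auto intro: finite_subset[of _ "{..<dim_vec v}"])

lemma sequence_of_vec_add:
  assumes "v \<in> carrier_vec N" "x \<in> carrier_vec N"
  shows "sequence_of_vec (v + x) = sequence_of_vec v + sequence_of_vec x"
  using assms by (intro poly_mapping_eqI) (auto simp: lookup_sequence_of_vec lookup_add)

lemma sequence_of_vec_smult: "sequence_of_vec (c \<cdot>\<^sub>v v) = c *\<^sub>R sequence_of_vec v"
  by (intro poly_mapping_eqI) (auto simp: lookup_sequence_of_vec scaleR_poly_mapping.rep_eq)

lemma inner_sequence_of_vec:
  assumes "v \<in> carrier_vec N" "x \<in> carrier_vec N"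
  shows "sequence_of_vec v \<bullet> sequence_of_vec x = scalar_prod v x"
proof -
  have "Poly_Mapping.keys (sequence_of_vec v) \<subseteq> {0..<N}"
    using assms by (auto simp: in_keys_iff lookup_sequence_of_vec split: if_splits)
  from inner_poly_mapping_superset[OF _ this] show ?thesis
    using assms by (simp add: lookup_sequence_of_vec scalar_prod_def)
qed

lemma norm_sequence_of_vec: "norm (sequence_of_vec v) = vnorm v"
  by (simp add: norm_eq_sqrt_inner vnorm_def inner_sequence_of_vec[of v "dim_vec v"])

lemma linear_operatorD:
  assumes "linear_operator N u"
  shows "x \<in> carrier_vec N \<Longrightarrow> u x \<in> carrier_vec N"
    and "x \<in> carrier_vec N \<Longrightarrow> y \<in> carrier_vec N \<Longrightarrow> u (x + y) = u x + u y"
    and "x \<in> carrier_vec N \<Longrightarrow> u (c \<cdot>\<^sub>v x) = c \<cdot>\<^sub>v u x"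
proof -
  interpret linear_map class_ring "ell2 N" "ell2 N" u by (rule assms)
  show "x \<in> carrier_vec N \<Longrightarrow> u x \<in> carrier_vec N"
    using f_im by (auto simp: module_vec_simps)
  show "x \<in> carrier_vec N \<Longrightarrow> y \<in> carrier_vec N \<Longrightarrow> u (x + y) = u x + u y"
    using f_add by (auto simp: module_vec_simps)
  show "x \<in> carrier_vec N \<Longrightarrow> u (c \<cdot>\<^sub>v x) = c \<cdot>\<^sub>v u x"
    using f_smult[of c x] by (auto simp: module_vec_simps)
qed

text \<open>By additivity along the truncations of \<open>x\<close> to its first \<open>k\<close> coordinates.\<close>

lemma linear_operator_expansion:
  assumes u: "linear_operator N u" and x: "x \<in> carrier_vec N"
  shows "sequence_of_vec (u x) = (\<Sum>i<N. x $ i *\<^sub>R sequence_of_vec (u (unit_vec N i)))"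
proof -
  note u = linear_operatorD[OF u]
  define x' where "x' k = vec N (\<lambda>i. if i < k then x $ i else 0)" for k
  have x': "x' k \<in> carrier_vec N" for k by (simp add: x'_def)
  have "k \<le> N \<Longrightarrow> sequence_of_vec (u (x' k)) = (\<Sum>i<k. x $ i *\<^sub>R sequence_of_vec (u (unit_vec N i)))" for k
  proof (induction k)
    case 0
    have "x' 0 = 0 \<cdot>\<^sub>v x' 0" by (intro eq_vecI) (auto simp: x'_def)
    then have "u (x' 0) = 0 \<cdot>\<^sub>v u (x' 0)" using u(3)[OF x'] by metis
    then have "sequence_of_vec (u (x' 0)) = 0 *\<^sub>R sequence_of_vec (u (x' 0))"
      by (metis sequence_of_vec_smult)
    then show ?case by simp
  next
    case (Suc k)
    have "x' (Suc k) = x' k + x $ k \<cdot>\<^sub>v unit_vec N k"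
      using Suc.prems by (intro eq_vecI) (auto simp: x'_def less_Suc_eq)
    then have "u (x' (Suc k)) = u (x' k) + x $ k \<cdot>\<^sub>v u (unit_vec N k)"
      using u(2)[OF x', of "x $ k \<cdot>\<^sub>v unit_vec N k" k] u(3)[of "unit_vec N k"] by simp
    then show ?case
      using Suc u(1) x' by (simp add: sequence_of_vec_add[of _ N] sequence_of_vec_smult)
  qed
  moreover have "x' N = x" using x by (intro eq_vecI) (auto simp: x'_def)
  ultimately show ?thesis by fastforce
qed

text \<open>The supremum defining the operator norm bounds its members only if the set is bounded above;
  with unit columns, \<open>N\<close> is an upper bound.\<close>

lemma op_norm_bound:
  assumes u: "linear_operator N u" and unit: "\<forall>j<N. vnorm (u (unit_vec N j)) = 1"
    and x: "x \<in> carrier_vec N"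
  shows "vnorm (u x) \<le> op_norm N u * vnorm x"
proof -
  have hom: "vnorm (u (c \<cdot>\<^sub>v y)) = \<bar>c\<bar> * vnorm (u y)" "vnorm (c \<cdot>\<^sub>v y) = \<bar>c\<bar> * vnorm y"
    if "y \<in> carrier_vec N" for c y
    using linear_operatorD(3)[OF u that]
    by (simp_all add: norm_sequence_of_vec[symmetric] sequence_of_vec_smult)
  have coord: "\<bar>y $ i\<bar> \<le> vnorm y" if "y \<in> carrier_vec N" "i < N" for y i
  proof -
    have "(y $ i)\<^sup>2 \<le> (\<Sum>i\<in>{0..<N}. (y $ i)\<^sup>2)"
      by (rule member_le_sum) (use that in auto)
    also have "\<dots> = scalar_prod y y" using that by (simp add: scalar_prod_def power2_eq_square)
    finally show ?thesis unfolding vnorm_def by (rule real_le_rsqrt[of "\<bar>y $ i\<bar>", simplified])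
  qed
  have bound: "vnorm (u y) \<le> real N" if y: "y \<in> carrier_vec N" "vnorm y \<le> 1" for y
  proof -
    have "vnorm (u y) \<le> (\<Sum>i<N. norm (y $ i *\<^sub>R sequence_of_vec (u (unit_vec N i))))"
      unfolding norm_sequence_of_vec[symmetric] linear_operator_expansion[OF u y(1)]
      by (rule norm_sum)
    also have "\<dots> \<le> (\<Sum>i<N. 1)"
      using coord[OF y(1)] y(2) unit by (intro sum_mono) (fastforce simp: norm_sequence_of_vec)
    finally show ?thesis by simp
  qed
  have upper: "vnorm (u y) \<le> op_norm N u" if "y \<in> carrier_vec N" "vnorm y \<le> 1" for y
    unfolding op_norm_def by (rule cSup_upper) (use that bound in \<open>auto intro!: bdd_aboveI\<close>)
  show ?thesis
  proof (cases "vnorm x = 0")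
    case True
    then have "x = 0 \<cdot>\<^sub>v x"
      using coord[OF x] True x by (intro eq_vecI) auto
    then have "vnorm (u x) = 0" using hom(1)[OF x, of 0] by simp
    then show ?thesis by (simp add: True)
  next
    case False
    then have pos: "vnorm x > 0" using norm_ge_zero[of "sequence_of_vec x"]
      by (simp add: norm_sequence_of_vec)
    have "vnorm (u (inverse (vnorm x) \<cdot>\<^sub>v x)) \<le> op_norm N u"
      using x pos by (intro upper) (auto simp: hom)
    then show ?thesis using pos by (simp add: hom[OF x] field_simps)
  qed
qed

lemma coord_subspaceD:
  assumes "x \<in> coord_subspace N \<sigma>"
  shows "x \<in> carrier_vec N" and "i < N \<Longrightarrow> i \<notin> \<sigma> \<Longrightarrow> x $ i = 0"
proof -
  interpret vec_space "TYPE(real)" N .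
  obtain a A where A: "finite A" "A \<subseteq> unit_vec N ` \<sigma>" and x: "x = lincomb a A"
    using assms unfolding coord_subspace_def span_def by auto
  have carrier: "A \<subseteq> carrier_vec N" using A by auto
  show "x \<in> carrier_vec N" unfolding x using carrier by (rule lincomb_closed)
  assume i: "i < N" "i \<notin> \<sigma>"
  have "x $ i = (\<Sum>v\<in>A. a v * v $ i)" unfolding x by (rule lincomb_index[OF i(1) carrier])
  also have "\<dots> = 0"
  proof (intro sum.neutral ballI)
    fix v assume "v \<in> A"
    then obtain j where "j \<in> \<sigma>" "v = unit_vec N j" using A(2) by blast
    then show "a v * v $ i = 0" using i by (auto simp: unit_vec_def)
  qed
  finally show "x $ i = 0" .
qed

text \<open>The left-hand side is \<open>|u\<^sup>T z|\<^sup>2\<close>, and it is bounded by applying \<open>u\<close> to \<open>y = u\<^sup>T z\<close>: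
  \<open>|y|\<^sup>2 = u y \<bullet> z \<le> \<parallel>u\<parallel> |y| |z|\<close>.\<close>

lemma op_norm_frame_bound:
  assumes u: "linear_operator N u" and unit: "\<forall>j<N. vnorm (u (unit_vec N j)) = 1"
  shows "(\<Sum>i<N. (sequence_of_vec (u (unit_vec N i)) \<bullet> z)\<^sup>2) \<le> (op_norm N u)\<^sup>2 * (z \<bullet> z)"
proof -
  define w where "w i = sequence_of_vec (u (unit_vec N i))" for i
  define y where "y = vec N (\<lambda>i. w i \<bullet> z)"
  define s where "s = (\<Sum>i<N. (w i \<bullet> z)\<^sup>2)"
  have y: "y \<in> carrier_vec N" by (simp add: y_def)
  have s0: "s \<ge> 0" by (simp add: s_def sum_nonneg)
  have ys: "vnorm y = sqrt s"
    by (simp add: vnorm_def scalar_prod_def y_def s_def power2_eq_square lessThan_atLeast0)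
  have "s = (\<Sum>i<N. y $ i *\<^sub>R w i) \<bullet> z"
    by (simp add: s_def y_def inner_sum_left power2_eq_square)
  also have "\<dots> = sequence_of_vec (u y) \<bullet> z"
    by (simp add: linear_operator_expansion[OF u y] w_def)
  also have "\<dots> \<le> vnorm (u y) * norm z"
    using norm_cauchy_schwarz[of "sequence_of_vec (u y)" z] by (simp add: norm_sequence_of_vec)
  also have "\<dots> \<le> op_norm N u * sqrt s * norm z"
    using op_norm_bound[OF u unit y] by (intro mult_right_mono) (auto simp: ys)
  finally have "sqrt s * sqrt s \<le> sqrt s * (op_norm N u * norm z)"
    using s0 by (simp add: mult.commute mult.left_commute)
  then have "s \<noteq> 0 \<Longrightarrow> sqrt s \<le> op_norm N u * norm z"
    using s0 mult_left_le_imp_le[of "sqrt s" "sqrt s" "op_norm N u * norm z"] by simp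
  then have "s \<noteq> 0 \<Longrightarrow> (sqrt s)\<^sup>2 \<le> (op_norm N u * norm z)\<^sup>2"
    using s0 by (intro power_mono) auto
  then have "s \<le> (op_norm N u * norm z)\<^sup>2" using s0 by (cases "s = 0") auto
  then show ?thesis by (simp add: s_def w_def power_mult_distrib power2_norm_eq_inner)
qed

theorem corollary1p4:
  fixes \<epsilon> :: real
  assumes "\<epsilon> > 0"
  shows "\<exists>c\<^sub>1 c\<^sub>2 :: real. c\<^sub>1 > 0 \<and> c\<^sub>2 > 0 \<and>
    (\<forall>(N::nat) (u :: real vec \<Rightarrow> real vec).
       N \<ge> 1 \<longrightarrow> linear_operator N u \<longrightarrow> (\<forall>j<N. vnorm (u (unit_vec N j)) = 1) \<longrightarrow>
       (\<exists>\<sigma> \<subseteq> {..<N}.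
          real (card \<sigma>) > (1 - \<epsilon>) * (real N / (op_norm N u)\<^sup>2) \<and>
          (\<forall>x \<in> coord_subspace N \<sigma>.
             c\<^sub>1 * vnorm x \<le> vnorm (u x) \<and> vnorm (u x) \<le> c\<^sub>2 * vnorm x)))"
proof -
  define e where "e = min \<epsilon> (1/2)"
  have e: "0 < e" "e \<le> 1/2" "e \<le> \<epsilon>" using assms by (auto simp: e_def)
  define c\<^sub>1 where "c\<^sub>1 = sqrt (e\<^sup>2/8)"
  define c\<^sub>2 where "c\<^sub>2 = sqrt (96/e\<^sup>2)"
  have "c\<^sub>1 > 0" "c\<^sub>2 > 0" using e by (auto simp: c\<^sub>1_def c\<^sub>2_def)
  moreover have "\<exists>\<sigma> \<subseteq> {..<N}. real (card \<sigma>) > (1 - \<epsilon>) * (real N / (op_norm N u)\<^sup>2) \<and>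
      (\<forall>x \<in> coord_subspace N \<sigma>. c\<^sub>1 * vnorm x \<le> vnorm (u x) \<and> vnorm (u x) \<le> c\<^sub>2 * vnorm x)"
    if N: "N \<ge> 1" and u: "linear_operator N u" and unit: "\<forall>j<N. vnorm (u (unit_vec N j)) = 1"
    for N and u :: "real vec \<Rightarrow> real vec"
  proof -
    define w where "w i = sequence_of_vec (u (unit_vec N i))" for i
    have I: "finite {..<N}" "{..<N} \<noteq> {}" using N by (auto simp: lessThan_empty_iff)
    have w_unit: "w i \<bullet> w i = 1" if "i \<in> {..<N}" for i
      using that unit by (simp add: w_def norm_sequence_of_vec flip: power2_norm_eq_inner)
    obtain \<sigma> where \<sigma>: "\<sigma> \<subseteq> {..<N}" "(1 - e) * (N / (op_norm N u)\<^sup>2) < card \<sigma>"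
      and lower: "\<And>y. e\<^sup>2/8 * (\<Sum>j\<in>\<sigma>. (y j)\<^sup>2) \<le> (\<Sum>j\<in>\<sigma>. y j *\<^sub>R w j) \<bullet> (\<Sum>j\<in>\<sigma>. y j *\<^sub>R w j)"
      and upper: "\<And>y. (\<Sum>j\<in>\<sigma>. y j *\<^sub>R w j) \<bullet> (\<Sum>j\<in>\<sigma>. y j *\<^sub>R w j) \<le> 96/e\<^sup>2 * (\<Sum>j\<in>\<sigma>. (y j)\<^sup>2)"
      using well_conditioned_subfamily[OF e(1,2) I w_unit op_norm_frame_bound[OF u unit, folded w_def]]
      by (simp only: card_lessThan) blast
    have "(1 - \<epsilon>) * (N / (op_norm N u)\<^sup>2) \<le> (1 - e) * (N / (op_norm N u)\<^sup>2)"
      using e by (intro mult_right_mono) auto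
    with \<sigma>(2) have "(1 - \<epsilon>) * (N / (op_norm N u)\<^sup>2) < card \<sigma>" by linarith
    moreover have "c\<^sub>1 * vnorm x \<le> vnorm (u x) \<and> vnorm (u x) \<le> c\<^sub>2 * vnorm x"
      if x: "x \<in> coord_subspace N \<sigma>" for x
    proof -
      note x = coord_subspaceD[OF x]
      have "sequence_of_vec (u x) = (\<Sum>i<N. x $ i *\<^sub>R w i)"
        unfolding w_def by (rule linear_operator_expansion[OF u x(1)])
      also have "\<dots> = (\<Sum>i\<in>\<sigma>. x $ i *\<^sub>R w i)"
        using \<sigma>(1) x(2) by (intro sum.mono_neutral_right) auto
      finally have ux: "sequence_of_vec (u x) = (\<Sum>i\<in>\<sigma>. x $ i *\<^sub>R w i)" .
      have "scalar_prod x x = (\<Sum>i<N. (x $ i)\<^sup>2)"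
        using x(1) by (simp add: scalar_prod_def power2_eq_square lessThan_atLeast0)
      also have "\<dots> = (\<Sum>i\<in>\<sigma>. (x $ i)\<^sup>2)"
        using \<sigma>(1) x(2) by (intro sum.mono_neutral_right) auto
      finally have xx: "vnorm x = sqrt (\<Sum>i\<in>\<sigma>. (x $ i)\<^sup>2)" by (simp add: vnorm_def)
      have "vnorm (u x) = sqrt (sequence_of_vec (u x) \<bullet> sequence_of_vec (u x))"
        by (simp add: norm_sequence_of_vec flip: norm_eq_sqrt_inner)
      then show ?thesis
        unfolding xx c\<^sub>1_def c\<^sub>2_def ux real_sqrt_mult[symmetric]
        using lower[of "($) x"] upper[of "($) x"] by simp
    qed
    ultimately show ?thesis using \<sigma>(1) by blast
  qed
  ultimately show ?thesis by blast
qed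

end
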